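(* Let $d\in\mathbb N$ and let $F$ be a $1$-periodic function on $\mathbb R^d$ (identified with a function on $[0,1)^d$) with $\|F\|_\infty<\infty$. Put $F^0(\mathbf x):=F(\mathbf x)-\hat F(\mathbf 0)$, and assume that $F^0$ is a real even function satisfying $\hat F^0(\mathbf k)\ge 0$ for all $\mathbf k\in\mathbb Z^d$, $\mathbf k\ne\mathbf 0$. Then for any $m\in\mathbb N$ there exists a set $\xi=\{\xi^j\}_{j=1}^m$ of points in $[0,1)^d$, namely one provided by the Averaging Search algorithm applied to $g=F^0$, such that $$Q_m(\mathbf W^F_1,\xi)\le \|F^0\|_\infty\, m^{-1/2}.$$
   Context: Fourier coefficients: $\hat G(\mathbf k)=\int_{[0,1)^d}G(\mathbf x)e^{-2\pi i(\mathbf k,\mathbf x)}d\mathbf x$. The class $\mathbf W^F_1$ is the set of all functions $f(\mathbf x)=\int_{[0,1)^d}F(\mathbf x-\mathbf y)\varphi(\mathbf y)\,d\mathbf y$ with $\|\varphi\|_{L_1([0,1)^d)}\le 1$. For points $\xi=(\xi^1,\dots,\xi^m)$ in $[0,1)^d$ the Quasi-Monte Carlo cubature formula is $Q_m(f,\xi)=\frac1m\sum_{j=1}^m f(\xi^j)$, and for a class $\mathbf W$ its error is $Q_m(\mathbf W,\xi)=\sup_{f\in\mathbf W}\left|\int_{[0,1)^d}f\,d\mathbf x-Q_m(f,\xi)\right|$. Averaging Search algorithm: given a real $1$-periodic $g\in L_1([0,1)^d)$ with $\int_{[0,1)^d}g=0$, choose any $\xi^1\in[0,1)^d$; for $n\ge2$,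 having $\xi^1,\dots,\xi^{n-1}$, choose $\xi^n\in[0,1)^d$ such that $\sum_{j=1}^{n-1}g(\xi^n-\xi^j)\le 0$ (such a point always exists). *)

theory Defs
  imports "HOL-Analysis.Analysis" "HOL-Probability.Essential_Supremum"
begin

definition unit_cube :: "(real ^ 'n) set" where
  "unit_cube = {x. \<forall>i. 0 \<le> x $ i \<and> x $ i < 1}"

definition int_vec :: "real ^ 'n \<Rightarrow> bool" where
  "int_vec k \<longleftrightarrow> (\<forall>i. k $ i \<in> \<int>)"

definition one_periodic :: "(real ^ 'n \<Rightarrow> 'b) \<Rightarrow> bool" where
  "one_periodic G \<longleftrightarrow> (\<forall>x k. int_vec k \<longrightarrow> G (x + k) = G x)"

definition fourier_coeff :: "(real ^ 'n \<Rightarrow> complex) \<Rightarrow> real ^ 'n \<Rightarrow> complex" where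
  "fourier_coeff G k =
     integral\<^sup>L (lebesgue_on unit_cube) (\<lambda>x. G x * exp (- 2 * pi * \<i> * complex_of_real (k \<bullet> x)))"

definition Linf_norm :: "(real ^ 'n \<Rightarrow> complex) \<Rightarrow> ereal" where
  "Linf_norm G = esssup (lebesgue_on unit_cube) (\<lambda>x. ereal (cmod (G x)))"

definition W_F_1 :: "(real ^ 'n \<Rightarrow> complex) \<Rightarrow> (real ^ 'n \<Rightarrow> complex) set" where
  "W_F_1 F = {f. \<exists>\<phi>. integrable (lebesgue_on unit_cube) \<phi> \<and>
                     (\<integral>y. cmod (\<phi> y) \<partial>lebesgue_on unit_cube) \<le> 1 \<and>
                     f = (\<lambda>x. \<integral>y. F (x - y) * \<phi> y \<partial>lebesgue_on unit_cube)}"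

definition qmc :: "nat \<Rightarrow> (nat \<Rightarrow> real ^ 'n) \<Rightarrow> (real ^ 'n \<Rightarrow> complex) \<Rightarrow> complex" where
  "qmc m \<xi> f = (\<Sum>j=1..m. f (\<xi> j)) / of_nat m"

definition qmc_error :: "nat \<Rightarrow> (nat \<Rightarrow> real ^ 'n) \<Rightarrow> (real ^ 'n \<Rightarrow> complex) set \<Rightarrow> ereal" where
  "qmc_error m \<xi> W =
     (SUP f\<in>W. ereal (cmod ((\<integral>x. f x \<partial>lebesgue_on unit_cube) - qmc m \<xi> f)))"

text \<open>xi 1, ..., xi m is a possible output of the Averaging Search algorithm for g:
  all points lie in [0,1)^d and for every 2 <= n <= m, sum_{j<n} g(xi n - xi j) <= 0.\<close>
definition averaging_search :: "(real ^ 'n \<Rightarrow> real) \<Rightarrow> nat \<Rightarrow> (nat \<Rightarrow> real ^ 'n) \<Rightarrow> bool" where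
  "averaging_search g m \<xi> \<longleftrightarrow>
     (\<forall>j\<in>{1..m}. \<xi> j \<in> unit_cube) \<and>
     (\<forall>n\<in>{2..m}. (\<Sum>j=1..n-1. g (\<xi> n - \<xi> j)) \<le> 0)"

end

theory Submission
  imports Defs
begin

text \<open>
  A bounded function \<open>F0\<close> with nonnegative Fourier coefficients has an absolutely summable Fourier
  series \<open>G\<close>: testing \<open>F0\<close> against squared Dirichlet kernels bounds the coefficient sum by the
  sup norm, and \<open>F0 = G\<close> almost everywhere by uniqueness of Fourier coefficients. Each search point
  is chosen so that, moreover, \<open>F0\<close> and \<open>G\<close> agree at all differences of points; the search
  condition then says that adding a point increases the energy \<open>\<Sum>\<^sub>k c\<^sub>k \<bar>\<Sum>\<^sub>j e\<^sub>k(\<xi>\<^sub>j)\<bar>\<^sup>2\<close>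
  by at most \<open>G(0) = \<Sum>\<^sub>k c\<^sub>k\<close>, so that it is at most \<open>m G(0)\<close> after \<open>m\<close> points.
  The error is at most \<open>m\<^sup>-\<^sup>1 \<Sum>\<^sub>k c\<^sub>k \<bar>\<Sum>\<^sub>j e\<^sub>k(\<xi>\<^sub>j)\<bar>\<close>, and
  Cauchy-Schwarz concludes.
\<close>

text \<open>The obstacle is null sets. \<open>W_F_1 F\<close> depends on \<open>F\<close> only up to
  a null set, while the search condition evaluates \<open>F0\<close> at finitely many differences of
  points. An arbitrary output of the search therefore need not work: if \<open>F0\<close> is changed
  to a negative value at the integer vectors, repeating one single point passes every test. Hence
  each step needs a set of candidates of positive measure, from which a null set can be discarded.
  It exists because a sum of translates of \<open>G\<close> has mean zero and so cannot be positive
  almost everywhere. Differences of points leave the cube, so almost everywhere equality on the cube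
  has to be spread periodically over the whole space.

  For the same reason the sum of the coefficients cannot be read off as the value of
  \<open>F0\<close> at 0 and compared with an essential supremum; integration against a nonnegative
  kernel replaces that evaluation. Uniqueness of coefficients is drawn from the Stone-Weierstrass
  theorem on a compact copy of the torus in \<open>complex ^ 'n\<close>.\<close>

section \<open>Characters of the torus and their orthogonality\<close>

definition torus_char :: "real ^ 'n \<Rightarrow> real ^ 'n \<Rightarrow> complex" where
  "torus_char k x = cis (2 * pi * (k \<bullet> x))"

abbreviation cube_measure :: "(real ^ 'n) measure" where
  "cube_measure \<equiv> lebesgue_on unit_cube"

lemma norm_torus_char [simp]: "cmod (torus_char k x) = 1"
  by (simp add: torus_char_def)

lemma torus_char_0_left [simp]: "torus_char 0 x = 1"
  by (simp add: torus_char_def)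

lemma torus_char_add_left: "torus_char (k + l) x = torus_char k x * torus_char l x"
  by (simp add: torus_char_def cis_mult inner_add_left ring_distribs)

lemma torus_char_add_right: "torus_char k (x + y) = torus_char k x * torus_char k y"
  by (simp add: torus_char_def cis_mult inner_add_right ring_distribs)

lemma torus_char_minus_left: "torus_char (- k) x = cnj (torus_char k x)"
  by (simp add: torus_char_def cis_cnj)

lemma torus_char_minus_right: "torus_char k (- x) = cnj (torus_char k x)"
  by (simp add: torus_char_def cis_cnj)

lemma torus_char_diff_left: "torus_char (k - l) x = torus_char k x * cnj (torus_char l x)"
  using torus_char_add_left[of k "- l" x] by (simp add: torus_char_minus_left)

lemma torus_char_diff_right: "torus_char k (x - y) = torus_char k x * cnj (torus_char k y)"
  using torus_char_add_right[of k x "- y"] by (simp add: torus_char_minus_right)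

lemma continuous_on_torus_char [continuous_intros]: "continuous_on A (torus_char k)"
  unfolding torus_char_def by (intro continuous_intros)

lemma borel_measurable_torus_char [measurable]: "torus_char k \<in> borel_measurable borel"
  by (simp add: borel_measurable_continuous_onI continuous_on_torus_char)

lemma torus_char_periodic:
  assumes "int_vec k" "int_vec l"
  shows "torus_char k (x + l) = torus_char k x"
proof -
  have "k \<bullet> l \<in> \<int>"
    unfolding inner_vec_def using assms by (auto simp: int_vec_def intro!: Ints_sum Ints_mult)
  then have "torus_char k l = 1"
    unfolding torus_char_def by (metis cis_multiple_2pi mult.assoc)
  then show ?thesis by (simp add: torus_char_add_right)
qed

lemma fourier_coeff_eq:
  "fourier_coeff G k = (\<integral>x. G x * cnj (torus_char k x) \<partial>cube_measure)"
  unfolding fourier_coeff_def torus_char_def cis_cnj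
  by (intro Bochner_Integration.integral_cong refl arg_cong2[where f="(*)"])
     (simp add: cis_conv_exp mult_ac)

lemma unit_cube_bounds: "box 0 1 \<subseteq> (unit_cube :: (real^'n) set)" "(unit_cube :: (real^'n) set) \<subseteq> cbox 0 1"
  by (auto simp: unit_cube_def mem_box_cart less_imp_le)

lemma unit_cube_borel [measurable]: "(unit_cube :: (real^'n) set) \<in> sets borel"
  unfolding unit_cube_def by measurable

lemma unit_cube_lebesgue [simp]: "(unit_cube :: (real^'n) set) \<in> sets lebesgue"
  using unit_cube_borel by (simp add: sets_completionI_sets)

text \<open>The character is a product of one-dimensional exponentials, so the integral factors over
  the coordinates; a coordinate with nonzero integer frequency runs through full periods and
  contributes the factor 0.\<close>

lemma integral_cube_char:
  fixes k :: "real ^ 'n"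
  assumes k: "int_vec k"
  shows "(\<integral>x. torus_char k x \<partial>cube_measure) = (if k = 0 then 1 else 0)"
proof -
  interpret product_sigma_finite "\<lambda>b::real^'n. lborel :: real measure" ..
  \<comment> \<open>The indicator is built into each factor, so that the product is supported on the
    cube and the product formula can be used over the whole space.\<close>
  define h :: "real ^ 'n \<Rightarrow> real \<Rightarrow> complex" where
    "h b t = indicator {0..<1} t * cis (2 * pi * ((k \<bullet> b) * t))" for b t
  have 1: "(\<integral>t. h b t \<partial>lborel) = (if k \<bullet> b = 0 then 1 else 0)" 
    and 2: "integrable lborel (h b)" if b: "b \<in> Basis" for b
  proof -
    define j where "j = k \<bullet> b"
    have j: "j \<in> \<int>" using b k unfolding j_def Basis_vec_def int_vec_def
      by (auto simp: inner_axis)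
    have "((\<lambda>t. cis (2 * pi * (j * t))) has_integral (if j = 0 then 1 else 0)) {0..1::real}"
    proof (cases "j = 0")
      case True then show ?thesis using has_integral_const_real[of "1::complex" 0 1] by simp
    next
      case False
      define c where "c = \<i> * complex_of_real (2 * pi * j)"
      have c: "c \<noteq> 0" using False by (simp add: c_def)
      define F where "F t = exp (c * complex_of_real t) / c" for t
      have cis_eq: "cis (2 * pi * (j * t)) = exp (c * complex_of_real t)" for t
        by (simp add: cis_conv_exp c_def mult_ac)
      have "((\<lambda>t. exp (c * complex_of_real t)) has_integral (F 1 - F 0)) {0..1::real}"
      proof (rule fundamental_theorem_of_calculus)
        fix t :: real
        have "((\<lambda>z. exp (c * z) / c) has_field_derivative exp (c * complex_of_real t)) (at (complex_of_real t))"
          using c by (auto intro!: derivative_eq_intros)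
        then show "(F has_vector_derivative exp (c * complex_of_real t)) (at t within {0..1})"
          unfolding F_def by (rule has_vector_derivative_real_field)
      qed simp
      moreover have "F 1 = F 0" using cis_multiple_2pi[OF j] cis_eq[of 1] by (simp add: F_def mult.assoc)
      ultimately show ?thesis using False by (simp add: cis_eq)
    qed
    then have hi: "((\<lambda>t. cis (2 * pi * (j * t))) has_integral (if j = 0 then 1 else 0)) {0..<1::real}"
      by (rule has_integral_spike_set_eq[THEN iffD1, rotated 2]) (rule negligible_subset[OF negligible_sing[of 1]], force)+

    have si: "set_integrable lborel {0..<1::real} (\<lambda>t. cis (2 * pi * (j * t)))"
      by (rule set_integrable_subset[of _ "{0..1}"], rule borel_integrable_atLeastAtMost')
         (auto intro!: continuous_intros)
    have h_eq: "h b = (\<lambda>t. indicator {0..<1} t *\<^sub>R cis (2 * pi * (j * t)))"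
      by (auto simp: h_def j_def fun_eq_iff indicator_def)
    show "integrable lborel (h b)"
      using si unfolding h_eq set_integrable_def .
    show "(\<integral>t. h b t \<partial>lborel) = (if k \<bullet> b = 0 then 1 else 0)"
      using set_borel_integral_eq_integral(2)[OF si] integral_unique[OF hi]
      unfolding h_eq set_lebesgue_integral_def j_def by simp
  qed
  have prod_h: "(\<Prod>b\<in>Basis. h b (x \<bullet> b)) = indicator unit_cube x *\<^sub>R torus_char k x" for x
  proof -
    have "(\<Prod>b\<in>Basis. h b (x \<bullet> b)) =
        (\<Prod>b\<in>Basis. indicator {0..<1} (x \<bullet> b)) * (\<Prod>b\<in>Basis. cis (2 * pi * ((k \<bullet> b) * (x \<bullet> b))))"
      by (simp add: h_def prod.distrib)
    also have "(\<Prod>b\<in>Basis. cis (2 * pi * ((k \<bullet> b) * (x \<bullet> b)))) = torus_char k x"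
    proof -
      have "2 * pi * (k \<bullet> x) = (\<Sum>b\<in>Basis. 2 * pi * ((k \<bullet> b) * (x \<bullet> b)))"
        unfolding euclidean_inner[of k x] sum_distrib_left ..
      then show ?thesis
        unfolding torus_char_def cis_conv_exp by (simp only: of_real_sum sum_distrib_left exp_sum finite_Basis)
    qed
    also have "(\<Prod>b\<in>Basis. indicator {0..<1} (x \<bullet> b)) = (indicator unit_cube x :: complex)"
    proof (cases "x \<in> unit_cube")
      case True
      then have "x \<bullet> b \<in> {0..<1}" if "b \<in> Basis" for b
        using that by (auto simp: unit_cube_def Basis_vec_def inner_axis)
      then show ?thesis using True by simp
    next
      case False
      then obtain i where "x $ i \<notin> {0..<1}" by (auto simp: unit_cube_def)
      then have "indicator {0..<1} (x \<bullet> axis i 1) = (0::complex)" by (simp add: inner_axis)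
      moreover have "axis i 1 \<in> (Basis :: (real^'n) set)" by (auto simp: Basis_vec_def)
      ultimately have "(\<Prod>b\<in>Basis. indicator {0..<1} (x \<bullet> b)) = (0::complex)"
        by (intro prod_zero finite_Basis) blast
      then show ?thesis using False by simp
    qed
    finally show ?thesis by (simp add: indicator_def)
  qed
  have "(\<integral>x. torus_char k x \<partial>cube_measure) = (\<integral>x. indicator unit_cube x *\<^sub>R torus_char k x \<partial>lebesgue)"
    by (simp add: integral_restrict_space)
  also have "\<dots> = (\<integral>x. indicator unit_cube x *\<^sub>R torus_char k x \<partial>lborel)"
    by (rule integral_completion) measurable
  also have "\<dots> = (\<integral>x. (\<Prod>b\<in>Basis. h b (x \<bullet> b)) \<partial>lborel)"
    by (simp add: prod_h)
  also have "\<dots> = (\<integral>f. (\<Prod>b\<in>Basis. h b (f b)) \<partial>(\<Pi>\<^sub>M b\<in>Basis. lborel))"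
  proof (subst lborel_eq, subst integral_distr)
    show "(\<lambda>x. \<Prod>b\<in>Basis. h b (x \<bullet> b)) \<in> borel_measurable borel"
      unfolding prod_h by measurable
  qed (auto intro!: Bochner_Integration.integral_cong prod.cong)
  also have "\<dots> = (\<Prod>b\<in>Basis. (\<integral>t. h b t \<partial>lborel))"
    by (rule product_integral_prod) (auto simp: 2)
  also have "\<dots> = (if k = 0 then 1 else 0)"
    using euclidean_all_zero_iff[of k] by (auto simp: 1)
  finally show ?thesis .
qed

section \<open>Measure and integrability on the half-open cube\<close>

lemma borel_measurable_cubeI:
  "f \<in> borel_measurable borel \<Longrightarrow> f \<in> borel_measurable cube_measure"
  by (intro measurable_restrict_space1 measurable_completion) simp

lemma torus_char_cube [measurable]: "torus_char k \<in> borel_measurable cube_measure"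
  by (rule borel_measurable_cubeI) simp

lemma inner_Basis_one: "b \<in> Basis \<Longrightarrow> (1 :: real^'n) \<bullet> b = 1"
  by (auto simp: Basis_vec_def inner_axis)

lemma emeasure_unit_cube: "emeasure lebesgue (unit_cube :: (real^'n) set) = 1"
proof -
  let ?U = "unit_cube :: (real^'n) set"
  have "emeasure lebesgue (box 0 1 :: (real^'n) set) = 1" "emeasure lebesgue (cbox 0 1 :: (real^'n) set) = 1"
    by (simp_all add: emeasure_lborel_box_eq emeasure_lborel_cbox_eq inner_Basis_one)
  moreover have "emeasure lebesgue (box 0 1 :: (real^'n) set) \<le> emeasure lebesgue ?U"
    "emeasure lebesgue ?U \<le> emeasure lebesgue (cbox 0 1 :: (real^'n) set)"
    by (intro emeasure_mono unit_cube_bounds; simp)+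
  ultimately show ?thesis by simp
qed

lemma finite_measure_cube: "finite_measure (cube_measure :: (real^'n) measure)"
  by (rule finite_measureI) (simp add: emeasure_restrict_space emeasure_unit_cube)

lemma integrable_mult_bounded:
  fixes f g :: "'a \<Rightarrow> complex"
  assumes f: "integrable M f" and g: "g \<in> borel_measurable M" and B: "AE x in M. cmod (g x) \<le> B"
  shows "integrable M (\<lambda>x. f x * g x)"
proof (rule Bochner_Integration.integrable_bound)
  show "integrable M (\<lambda>x. B * cmod (f x))" using f by simp
  show "(\<lambda>x. f x * g x) \<in> borel_measurable M" using f g by measurable
  show "AE x in M. norm (f x * g x) \<le> norm (B * cmod (f x))"
    using B
  proof eventually_elim
    case (elim x)
    then have "cmod (f x) * cmod (g x) \<le> cmod (f x) * B" by (intro mult_left_mono) auto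
    also have "\<dots> \<le> \<bar>B * cmod (f x)\<bar>" by (simp add: mult.commute)
    finally show ?case by (simp add: norm_mult)
  qed
qed

section \<open>Uniqueness of Fourier coefficients\<close>

text \<open>Integrability is part of the notion because the integral of a non-integrable function is
  0 by convention, so such functions would qualify trivially.\<close>

definition vanishing_coeffs :: "(real ^ 'n \<Rightarrow> complex) \<Rightarrow> bool" where
  "vanishing_coeffs D \<longleftrightarrow>
     integrable cube_measure D \<and> (\<forall>k. int_vec k \<longrightarrow> fourier_coeff D k = 0)"

lemma integrable_mult_char:
  assumes "integrable cube_measure D"
  shows "integrable cube_measure (\<lambda>x. D x * torus_char k x)"
    "integrable cube_measure (\<lambda>x. D x * cnj (torus_char k x))"
proof -
  show *: "integrable cube_measure (\<lambda>x. D x * torus_char k x)" for k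
    by (rule integrable_mult_bounded[where B=1]) (use assms in auto)
  from *[of "- k"] show "integrable cube_measure (\<lambda>x. D x * cnj (torus_char k x))"
    by (simp add: torus_char_minus_left)
qed

lemma vanishing_coeffs_sum:
  fixes D :: "'b \<Rightarrow> real ^ 'n \<Rightarrow> complex"
  assumes "\<And>b. b \<in> B \<Longrightarrow> vanishing_coeffs (D b)"
  shows "vanishing_coeffs (\<lambda>x. \<Sum>b\<in>B. D b x)"
  unfolding vanishing_coeffs_def fourier_coeff_eq
proof (intro conjI allI impI)
  show "integrable cube_measure (\<lambda>x. \<Sum>b\<in>B. D b x)"
    using assms by (auto simp: vanishing_coeffs_def)
  fix k :: "real ^ 'n" assume "int_vec k"
  have "(\<integral>x. (\<Sum>b\<in>B. D b x) * cnj (torus_char k x) \<partial>cube_measure) =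
     (\<Sum>b\<in>B. (\<integral>x. D b x * cnj (torus_char k x) \<partial>cube_measure))"
    unfolding sum_distrib_right
    by (rule Bochner_Integration.integral_sum)
       (use assms in \<open>auto simp: vanishing_coeffs_def intro!: integrable_mult_char\<close>)
  also have "\<dots> = 0"
    using assms \<open>int_vec k\<close> by (auto simp: vanishing_coeffs_def fourier_coeff_eq)
  finally show "(\<integral>x. (\<Sum>b\<in>B. D b x) * cnj (torus_char k x) \<partial>cube_measure) = 0" .
qed

lemma vanishing_coeffs_add:
  assumes "vanishing_coeffs D" "vanishing_coeffs E"
  shows "vanishing_coeffs (\<lambda>x. D x + E x)"
  using vanishing_coeffs_sum[of "UNIV :: bool set" "\<lambda>b. if b then D else E"] assms
  by (simp add: UNIV_bool add.commute)

text \<open>Multiplication by a character shifts the coefficients by \<open>l\<close>, and integer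
  vectors are closed under this shift.\<close>

lemma vanishing_coeffs_mult_char:
  assumes "vanishing_coeffs D" "int_vec l"
  shows "vanishing_coeffs (\<lambda>x. c * D x * torus_char l x)"
proof -
  have "fourier_coeff (\<lambda>x. c * D x * torus_char l x) k = c * fourier_coeff D (k - l)" for k
    unfolding fourier_coeff_eq torus_char_diff_left by (simp add: mult_ac)
  moreover have "int_vec (k - l)" if "int_vec k" for k
    using that assms(2) by (auto simp: int_vec_def)
  moreover have "integrable cube_measure (\<lambda>x. c * D x * torus_char l x)"
    by (rule integrable_mult_char) (use assms in \<open>simp add: vanishing_coeffs_def\<close>)
  ultimately show ?thesis using assms by (simp add: vanishing_coeffs_def)
qed

text \<open>The half-open cube is not compact, but it is wrapped into the compact set
  \<open>torus\<close>, where continuous functions are uniform limits of polynomials. Real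
  polynomials in these coordinates become trigonometric polynomials on the cube.\<close>

definition torus_embed :: "real ^ 'n \<Rightarrow> complex ^ 'n" where
  "torus_embed x = (\<chi> i. torus_char (axis i 1) x)"

lemma torus_embed_nth: "torus_embed x $ i = cis (2 * pi * x $ i)"
  by (simp add: torus_embed_def torus_char_def inner_axis')

lemma continuous_on_torus_embed [continuous_intros]: "continuous_on A torus_embed"
  unfolding torus_embed_def by (intro continuous_intros)

definition torus :: "(complex ^ 'n) set" where
  "torus = {z. \<forall>i. cmod (z $ i) = 1}"

lemma torus_embed_in_torus: "torus_embed x \<in> torus"
  by (simp add: torus_def torus_embed_nth)

lemma compact_torus: "compact (torus :: (complex^'n) set)"
proof -
  have "closed (torus :: (complex^'n) set)"
    unfolding torus_def by (intro closed_Collect_all closed_Collect_eq continuous_intros)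
  moreover have "bounded (torus :: (complex^'n) set)"
    unfolding bounded_iff
  proof (intro exI ballI)
    fix z :: "complex^'n" assume z: "z \<in> torus"
    have "norm z \<le> (\<Sum>i\<in>UNIV. norm (z $ i))"
      unfolding norm_vec_def by (rule L2_set_le_sum) simp
    then show "norm z \<le> real CARD('n)" using z by (simp add: torus_def)
  qed
  ultimately show ?thesis by (simp add: compact_eq_bounded_closed)
qed

text \<open>Equal images force coordinate differences to be integers, and in a half-open cube such
  differences have absolute value below 1.\<close>

lemma inj_on_torus_embed: "inj_on torus_embed unit_cube"
proof (rule inj_onI, rule vec_eq_iff[THEN iffD2], intro allI)
  fix x y :: "real^'n" and i assume xy: "x \<in> unit_cube" "y \<in> unit_cube" "torus_embed x = torus_embed y"
  then have "cis (2 * pi * x $ i) = cis (2 * pi * y $ i)" by (metis torus_embed_nth)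
  then have "cis (2 * pi * x $ i - 2 * pi * y $ i) = 1" by (metis cis_divide cis_neq_zero divide_self)
  then have "cis (2 * pi * (x $ i - y $ i)) = 1" by (simp add: right_diff_distrib)
  then obtain n :: int where "2 * pi * (x $ i - y $ i) = of_int (2 * n) * pi"
    using cos_one_2pi_int[of "2 * pi * (x $ i - y $ i)"] by (auto simp: complex_eq_iff mult_ac)
  then have "pi * (2 * (x $ i - y $ i)) = pi * (2 * of_int n)" by simp
  then have "x $ i - y $ i = of_int n" unfolding mult_cancel_left by simp
  moreover have "\<bar>x $ i - y $ i\<bar> < 1" using xy by (auto simp: unit_cube_def abs_if) (smt (verit))+
  ultimately have "\<bar>n\<bar> < 1" by (metis of_int_abs of_int_less_1_iff)
  then have "n = 0" by simp
  then show "x $ i = y $ i" using \<open>x $ i - y $ i = of_int n\<close> by simp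
qed

lemma integrable_mult_embed:
  fixes h :: "complex ^ 'n \<Rightarrow> real"
  assumes D: "integrable cube_measure D" and h: "continuous_on UNIV h"
  shows "integrable cube_measure (\<lambda>x. D x * complex_of_real (h (torus_embed x)))"
proof -
  have "bounded (h ` torus)"
    by (rule compact_imp_bounded, rule compact_continuous_image[OF _ compact_torus])
       (rule continuous_on_subset[OF h], simp)
  then obtain B where B: "\<And>z. z \<in> torus \<Longrightarrow> norm (h z) \<le> B"
    by (auto simp: bounded_iff)
  have m: "(\<lambda>x. complex_of_real (h (torus_embed x))) \<in> borel_measurable cube_measure"
    by (rule borel_measurable_cubeI, rule borel_measurable_continuous_onI)
       (intro continuous_intros continuous_on_compose2[OF h]; simp)
  show ?thesis
    by (rule integrable_mult_bounded[OF D m, of B]) (use B torus_embed_in_torus in auto)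
qed

text \<open>
  Stating closure under multiplication for all \<open>D\<close> at once makes the product case of the induction
  trivial and avoids spans of characters.
\<close>

lemma vanishing_coeffs_mult_polynomial:
  fixes p :: "complex ^ 'n \<Rightarrow> real"
  assumes "real_polynomial_function p" "vanishing_coeffs D"
  shows "vanishing_coeffs (\<lambda>x. D x * complex_of_real (p (torus_embed x)))"
  using assms
proof (induction arbitrary: D)
  case (linear p)
  have p_eq: "p z = (\<Sum>b\<in>Basis. (z \<bullet> b) * p b)" for z
  proof -
    interpret bounded_linear p by fact
    have "p z = p (\<Sum>b\<in>Basis. (z \<bullet> b) *\<^sub>R b)" by (simp add: euclidean_representation)
    then show ?thesis by (simp add: sum scaleR)
  qed
  have *: "vanishing_coeffs (\<lambda>x. D x * complex_of_real ((torus_embed x \<bullet> b) * p b))" if b: "b \<in> Basis" for b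
  proof -
    obtain i u where bi: "b = axis i u"
      using b by (auto simp: Basis_vec_def)
    define v :: complex where "v = of_real (p b) * cnj u / 2"
    define w :: complex where "w = of_real (p b) * u / 2"
    have i: "int_vec (axis i 1 :: real^'n)" "int_vec (- axis i 1 :: real^'n)"
      by (auto simp: int_vec_def axis_def)
    \<comment> \<open>The real inner product on \<open>complex\<close> is the real part of
      \<open>cnj u * z\<close>. A real coordinate of \<open>torus_embed x\<close> is thus a
      combination of one character and its conjugate, the character of the opposite
      frequency.\<close>
    have inner_eq: "complex_of_real (z \<bullet> u) = (cnj u * z + u * cnj z) / 2" for z
      by (simp add: complex_eq_iff inner_complex_def)
    have "complex_of_real ((torus_embed x \<bullet> b) * p b) =
       v * torus_char (axis i 1) x + w * torus_char (- axis i 1) x" for x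
    proof -
      have "torus_embed x \<bullet> b = torus_char (axis i 1) x \<bullet> u"
        by (simp add: bi inner_axis torus_embed_def)
      then show ?thesis
        unfolding v_def w_def torus_char_minus_left of_real_mult
        by (simp only: inner_eq) (simp add: field_simps)
    qed
    then show ?thesis
      using vanishing_coeffs_add[OF vanishing_coeffs_mult_char[OF linear.prems i(1), of v] vanishing_coeffs_mult_char[OF linear.prems i(2), of w]]
      by (simp add: algebra_simps)
  qed
  show ?case
    using vanishing_coeffs_sum[OF *, where B=Basis]
    by (subst p_eq) (simp add: sum_distrib_left)
next
  case (const c)
  then show ?case
    using vanishing_coeffs_mult_char[of D 0 "of_real c"] by (simp add: int_vec_def mult.commute)
next
  case (add f g)
  then show ?case
    using vanishing_coeffs_add[of "\<lambda>x. D x * complex_of_real (f (torus_embed x))" "\<lambda>x. D x * complex_of_real (g (torus_embed x))"]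
    by (simp add: ring_distribs)
next
  case (mult f g)
  then show ?case by (simp flip: mult.assoc)
qed

text \<open>Against a polynomial the integral is the coefficient at frequency 0 of a function with
  vanishing coefficients. Replacing \<open>h\<close> by a polynomial within \<open>e\<close> on
  \<open>torus\<close> costs at most \<open>e\<close> times the L1 norm of \<open>D\<close>.\<close>

lemma integral_mult_embed_eq_0:
  fixes h :: "complex ^ 'n \<Rightarrow> real"
  assumes D: "vanishing_coeffs D" and h: "continuous_on UNIV h"
  shows "(\<integral>x. D x * complex_of_real (h (torus_embed x)) \<partial>cube_measure) = 0" (is "?I = 0")
proof -
  have iD: "integrable cube_measure D" using D by (simp add: vanishing_coeffs_def)
  define A where "A = (\<integral>x. cmod (D x) \<partial>cube_measure)"
  have A: "A \<ge> 0" by (simp add: A_def)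
  have *: "cmod ?I \<le> e * A" if e: "e > 0" for e
  proof -
    obtain p where p: "real_polynomial_function p" and ap: "\<And>z. z \<in> torus \<Longrightarrow> \<bar>h z - p z\<bar> < e"
      using Stone_Weierstrass_real_polynomial_function[OF compact_torus continuous_on_subset[OF h] e] by auto
    have cp: "continuous_on UNIV p"
      using p continuous_on_polymonial_function real_polynomial_function_eq by blast
    have "vanishing_coeffs (\<lambda>x. D x * complex_of_real (p (torus_embed x)))"
      by (rule vanishing_coeffs_mult_polynomial[OF p D])
    then have "fourier_coeff (\<lambda>x. D x * complex_of_real (p (torus_embed x))) 0 = 0"
      unfolding vanishing_coeffs_def by (simp add: int_vec_def)
    then have "(\<integral>x. D x * complex_of_real (p (torus_embed x)) \<partial>cube_measure) = 0"
      by (simp add: fourier_coeff_eq)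
    then have "?I = (\<integral>x. D x * complex_of_real (h (torus_embed x)) - D x * complex_of_real (p (torus_embed x)) \<partial>cube_measure)"
      by (subst Bochner_Integration.integral_diff) (auto intro!: integrable_mult_embed iD h cp)
    also have "cmod \<dots> \<le> (\<integral>x. e * cmod (D x) \<partial>cube_measure)"
    proof (rule Bochner_Integration.integral_norm_bound_integral)
      show "integrable cube_measure (\<lambda>x. D x * complex_of_real (h (torus_embed x)) - D x * complex_of_real (p (torus_embed x)))"
        by (intro Bochner_Integration.integrable_diff integrable_mult_embed iD h cp)
      show "integrable cube_measure (\<lambda>x. e * cmod (D x))" using iD by simp
      fix x
      have "cmod (D x * complex_of_real (h (torus_embed x)) - D x * complex_of_real (p (torus_embed x)))
        = cmod (D x) * \<bar>h (torus_embed x) - p (torus_embed x)\<bar>"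
        by (metis norm_mult norm_of_real of_real_diff right_diff_distrib)
      also have "\<dots> \<le> cmod (D x) * e"
        using ap[OF torus_embed_in_torus[of x]] by (intro mult_left_mono) auto
      finally show "cmod (D x * complex_of_real (h (torus_embed x)) - D x * complex_of_real (p (torus_embed x))) \<le> e * cmod (D x)"
        by (simp add: mult.commute)
    qed
    finally show ?thesis by (simp add: A_def)
  qed
  have "cmod ?I \<le> e" if "e > 0" for e
  proof -
    \<comment> \<open>The denominator is \<open>A + 1\<close> because \<open>A\<close> may be
      0.\<close>
    have "cmod ?I \<le> e / (A + 1) * A" using that A by (intro *) simp
    also have "\<dots> \<le> e" using that A by (simp add: field_simps)
    finally show ?thesis .
  qed
  then have "cmod ?I \<le> 0" by (rule field_le_epsilon) simp
  then show ?thesis by simp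
qed

text \<open>By injectivity of the embedding, the indicator of \<open>C\<close> is the pullback of
  the indicator of the compact image \<open>K\<close>. The latter is a pointwise limit of continuous
  functions, and \<open>cmod (D x)\<close> dominates.\<close>

lemma integral_compact_eq_0:
  fixes D :: "real ^ 'n \<Rightarrow> complex"
  assumes D: "vanishing_coeffs D" and C: "compact C" "C \<subseteq> unit_cube"
  shows "(\<integral>x. D x * indicator C x \<partial>cube_measure) = 0"
proof (cases "C = {}")
  case False
  have iD: "integrable cube_measure D" using D by (simp add: vanishing_coeffs_def)
  define K where "K = torus_embed ` C"
  have K: "closed K" "K \<noteq> {}" using False C(1) unfolding K_def
    by (auto intro!: compact_imp_closed compact_continuous_image continuous_intros)
  \<comment> \<open>Equal to 1 on \<open>K\<close> and eventually 0 at each point off the closed set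
    \<open>K\<close>. Distance is measured in \<open>complex ^ 'n\<close>, so opposite faces of the
    cube are glued.\<close>
  define h where "h n z = max 0 (1 - real n * infdist z K)" for n :: nat and z
  have ch: "continuous_on UNIV (h n)" for n
    unfolding h_def by (intro continuous_intros)
  have in_K: "torus_embed x \<in> K \<longleftrightarrow> x \<in> C" if "x \<in> unit_cube" for x
    using that C(2) inj_on_torus_embed unfolding K_def by (auto dest: inj_onD)
  have lim: "(\<lambda>n. h n (torus_embed x)) \<longlonglongrightarrow> indicator C x" if x: "x \<in> unit_cube" for x
  proof (cases "x \<in> C")
    case True
    then have "infdist (torus_embed x) K = 0" using in_K[OF x] by simp
    then show ?thesis using True by (simp add: h_def)
  next
    case False
    then have "infdist (torus_embed x) K > 0"
      using in_K[OF x] K infdist_pos_not_in_closed by blast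
    then obtain N where N: "1 < real N * infdist (torus_embed x) K"
      using reals_Archimedean3 by blast
    have "h n (torus_embed x) = 0" if "n \<ge> N" for n
    proof -
      have "real N * infdist (torus_embed x) K \<le> real n * infdist (torus_embed x) K"
        using that by (intro mult_right_mono infdist_nonneg) simp
      then show ?thesis using N by (simp add: h_def)
    qed
    then have "\<forall>\<^sub>F n in sequentially. h n (torus_embed x) = 0"
      by (rule eventually_sequentiallyI)
    then show ?thesis using False by (simp add: tendsto_eventually)
  qed
  have C_meas [measurable]: "C \<in> sets borel" using C(1) by (simp add: compact_imp_closed)
  have "(\<lambda>n. \<integral>x. D x * complex_of_real (h n (torus_embed x)) \<partial>cube_measure)
    \<longlonglongrightarrow> (\<integral>x. D x * indicator C x \<partial>cube_measure)"
  proof (rule integral_dominated_convergence[where w="\<lambda>x. cmod (D x)"])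
    have "(indicator C :: _ \<Rightarrow> complex) \<in> borel_measurable cube_measure"
      by (rule borel_measurable_cubeI) simp
    then show "(\<lambda>x. D x * indicator C x) \<in> borel_measurable cube_measure"
      using borel_measurable_integrable[OF iD] by measurable
    show "(\<lambda>x. D x * complex_of_real (h n (torus_embed x))) \<in> borel_measurable cube_measure" for n
      by (rule borel_measurable_integrable, rule integrable_mult_embed[OF iD ch])
    show "AE x in cube_measure. (\<lambda>n. D x * complex_of_real (h n (torus_embed x))) \<longlonglongrightarrow> D x * indicator C x"
    proof (rule AE_I2)
      fix x assume "x \<in> space (cube_measure :: (real^'n) measure)"
      then have "(\<lambda>n. complex_of_real (h n (torus_embed x))) \<longlonglongrightarrow> of_real (indicator C x)"
        by (intro tendsto_of_real lim) simp
      then show "(\<lambda>n. D x * complex_of_real (h n (torus_embed x))) \<longlonglongrightarrow> D x * indicator C x"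
        by (intro tendsto_mult tendsto_const) (simp add: of_real_indicator)
    qed
    show "AE x in cube_measure. norm (D x * complex_of_real (h n (torus_embed x))) \<le> cmod (D x)" for n
      by (auto simp: norm_mult h_def abs_if infdist_nonneg intro!: mult_left_le)
  qed (use iD in simp)
  then show ?thesis
    by (simp add: integral_mult_embed_eq_0[OF D ch] LIMSEQ_const_iff)
qed simp

text \<open>By inner regularity, a positivity set of positive measure contains a compact subset of
  positive measure. On that subset a strictly positive function would have integral 0.\<close>

lemma AE_nonpos_if_integral_compact_0:
  fixes d :: "real ^ 'n \<Rightarrow> real"
  assumes d: "integrable cube_measure d"
    and 0: "\<And>C. compact C \<Longrightarrow> C \<subseteq> unit_cube \<Longrightarrow> (\<integral>x. d x * indicator C x \<partial>cube_measure) = 0"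
  shows "AE x in cube_measure. d x \<le> 0"
proof (rule ccontr)
  define P where "P = {x \<in> unit_cube. d x > 0}"
  have [measurable]: "d \<in> borel_measurable cube_measure" using d by simp
  have "{x \<in> space cube_measure. d x > 0} \<in> sets cube_measure" by measurable
  then have P_cube: "P \<in> sets cube_measure" by (simp add: P_def)
  then have P: "P \<in> sets lebesgue" "P \<subseteq> unit_cube"
    by (simp_all add: sets_restrict_space_iff)
  have em: "emeasure cube_measure A = emeasure lebesgue A" if "A \<subseteq> unit_cube" for A :: "(real^'n) set"
    using that by (simp add: emeasure_restrict_space)
  assume "\<not> (AE x in cube_measure. d x \<le> 0)"
  then have "emeasure cube_measure P \<noteq> 0"
    using P_cube by (subst (asm) AE_iff_measurable[of P]) (auto simp: P_def)
  moreover have "emeasure cube_measure P \<noteq> \<infinity>"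
    using finite_measure.emeasure_finite[OF finite_measure_cube] by auto
  ultimately obtain e where e: "e > 0" "emeasure lebesgue P = ennreal e"
    using em[OF P(2)] by (cases "emeasure lebesgue P") (auto simp: order_less_le)
  \<comment> \<open>The tolerance is the measure \<open>e\<close> of \<open>P\<close> itself: if
    \<open>T\<close> were null, \<open>P - T\<close> would still have measure
    \<open>e\<close>.\<close>
  obtain T where T: "closed T" "T \<subseteq> P" "P - T \<in> lmeasurable" "emeasure lebesgue (P - T) < ennreal e"
    using sets_lebesgue_inner_closed[OF P(1) e(1)] by metis
  have TU: "T \<subseteq> unit_cube" using T P by auto
  have cT: "compact T"
    using T(1) TU unit_cube_bounds(2) by (metis bounded_cbox bounded_subset compact_eq_bounded_closed order_trans)
  have [measurable]: "(indicator T :: _ \<Rightarrow> real) \<in> borel_measurable cube_measure"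
    by (rule borel_measurable_cubeI) (use T(1) in simp)
  have i: "integrable cube_measure (\<lambda>x. d x * indicator T x)"
    by (rule Bochner_Integration.integrable_bound[OF d], measurable) (auto simp: indicator_def)
  have nn: "d x * indicator T x \<ge> 0" for x using T(2) by (auto simp: indicator_def P_def)
  have "AE x in cube_measure. d x * indicator T x = 0"
    using integral_nonneg_eq_0_iff_AE[OF i] nn 0[OF cT TU] by simp
  then have "AE x in cube_measure. x \<notin> T"
    by eventually_elim (use T(2) in \<open>auto simp: P_def indicator_def split: if_splits\<close>)
  then have "emeasure cube_measure T = 0"
    using TU T(1) by (subst (asm) AE_iff_measurable[of T]) (auto simp: sets_restrict_space_iff)
  then have "emeasure lebesgue T = 0" using em[OF TU] by simp
  moreover have "emeasure lebesgue (T \<union> (P - T)) \<le> emeasure lebesgue T + emeasure lebesgue (P - T)"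
    by (rule emeasure_subadditive) (use T(1,3) in auto)
  moreover have "T \<union> (P - T) = P" using T(2) by blast
  ultimately show False using T(4) e(2) by (metis add_0 leD)
qed

theorem fourier_uniqueness:
  fixes D :: "real ^ 'n \<Rightarrow> complex"
  assumes D: "vanishing_coeffs D"
  shows "AE x in cube_measure. D x = 0"
proof -
  have iD: "integrable cube_measure D" using D by (simp add: vanishing_coeffs_def)
  \<comment> \<open>\<open>L\<close> stands for the real part, the imaginary part and their
    negatives; four one-sided bounds together give 0.\<close>
  have *: "AE x in cube_measure. L (D x) \<le> 0" if L: "bounded_linear L" and L_ind: "\<And>z (C :: (real^'n) set) x. L (z * indicator C x) = L z * indicator C x"
    for L :: "complex \<Rightarrow> real"
  proof (rule AE_nonpos_if_integral_compact_0)
    show "integrable cube_measure (\<lambda>x. L (D x))" by (rule integrable_bounded_linear[OF L iD])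
    fix C :: "(real^'n) set" assume C: "compact C" "C \<subseteq> unit_cube"
    have "(indicator C :: _ \<Rightarrow> complex) \<in> borel_measurable cube_measure"
      by (rule borel_measurable_cubeI, rule borel_measurable_indicator) (use C(1) in \<open>simp add: compact_imp_closed\<close>)
    then have "integrable cube_measure (\<lambda>x. D x * indicator C x)"
      by (rule integrable_mult_bounded[OF iD, where B=1]) (auto simp: indicator_def)
    then have "(\<integral>x. L (D x * indicator C x) \<partial>cube_measure) = L (\<integral>x. D x * indicator C x \<partial>cube_measure)"
      by (rule integral_bounded_linear[OF L])
    then show "(\<integral>x. L (D x) * indicator C x \<partial>cube_measure) = 0"
      by (simp add: L_ind integral_compact_eq_0[OF D C] linear_0[OF bounded_linear.linear[OF L]])
  qed
  have "AE x in cube_measure. Re (D x) \<le> 0" "AE x in cube_measure. Im (D x) \<le> 0"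
    by (rule *; auto intro: bounded_linear_Re bounded_linear_Im simp: indicator_def)+
  moreover have "AE x in cube_measure. - Re (D x) \<le> 0" "AE x in cube_measure. - Im (D x) \<le> 0"
    by (rule *; auto intro: bounded_linear_minus bounded_linear_Re bounded_linear_Im simp: indicator_def)+
  ultimately show ?thesis
    by eventually_elim (simp add: complex_eq_iff)
qed

section \<open>Bounded functions with nonnegative coefficients have summable coefficients\<close>

definition int_box :: "nat \<Rightarrow> (real ^ 'n) set" where
  "int_box N = {k. int_vec k \<and> (\<forall>i. \<bar>k $ i\<bar> \<le> real N)}"

lemma card_int_box: "card (int_box N :: (real ^ 'n) set) = (2 * N + 1) ^ CARD('n)"
proof -
  define v :: "('n \<Rightarrow> int) \<Rightarrow> real ^ 'n" where "v g = (\<chi> i. of_int (g i))" for g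
  have "inj v" by (rule injI) (auto simp: v_def vec_eq_iff)
  moreover have "v ` (UNIV \<rightarrow>\<^sub>E {- int N..int N}) = int_box N"
  proof (intro set_eqI iffI)
    fix k :: "real ^ 'n" assume "k \<in> v ` (UNIV \<rightarrow>\<^sub>E {- int N..int N})"
    then obtain g where g: "k = v g" and gN: "g \<in> UNIV \<rightarrow>\<^sub>E {- int N..int N}" by auto
    have "g i \<in> {- int N..int N}" for i using gN by (rule PiE_mem) simp
    then have "\<bar>g i\<bar> \<le> int N" for i by (simp add: abs_le_iff minus_le_iff)
    then have "\<bar>real_of_int (g i)\<bar> \<le> real N" for i
      by (metis of_int_abs of_int_le_iff of_int_of_nat_eq)
    then show "k \<in> int_box N" by (auto simp: int_box_def g v_def int_vec_def)
  next
    fix k :: "real ^ 'n" assume k: "k \<in> int_box N"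
    then have fl: "real_of_int \<lfloor>k $ i\<rfloor> = k $ i" for i
      by (auto simp: int_box_def int_vec_def elim: Ints_cases)
    have "- int N \<le> \<lfloor>k $ i\<rfloor>" "\<lfloor>k $ i\<rfloor> \<le> int N" for i
      using k fl[of i] unfolding int_box_def by (simp_all add: abs_le_iff le_floor_iff floor_le_iff) (smt (verit))+
    then show "k \<in> v ` (UNIV \<rightarrow>\<^sub>E {- int N..int N})"
      by (intro image_eqI[of _ _ "\<lambda>i. \<lfloor>k $ i\<rfloor>"]) (auto simp: v_def vec_eq_iff fl)
  qed
  ultimately have "card (int_box N :: (real ^ 'n) set) = card ((UNIV :: 'n set) \<rightarrow>\<^sub>E {- int N..int N})"
    by (metis card_image inj_on_subset subset_UNIV)
  also have "\<dots> = (2 * N + 1) ^ CARD('n)"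
    by (simp add: card_PiE nat_add_distrib nat_mult_distrib)
  finally show ?thesis .
qed

lemma finite_int_box: "finite (int_box N :: (real ^ 'n) set)"
  by (rule card_ge_0_finite) (simp add: card_int_box)

lemma int_vec_arith: "int_vec k \<Longrightarrow> int_vec l \<Longrightarrow> int_vec (k + l)"
  "int_vec k \<Longrightarrow> int_vec l \<Longrightarrow> int_vec (k - l)" "int_vec k \<Longrightarrow> int_vec (- k)" "int_vec 0"
  by (auto simp: int_vec_def)

lemma dirichlet_square:
  fixes B :: "(real ^ 'n) set"
  shows "complex_of_real ((cmod (\<Sum>l\<in>B. torus_char l x))\<^sup>2) =
    (\<Sum>l\<in>B. \<Sum>l'\<in>B. torus_char (l - l') x)"
  unfolding complex_norm_square
  by (simp add: torus_char_diff_left sum_product)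

text \<open>The left side is the real part of the integral of \<open>f\<close> against the squared
  modulus \<open>K\<close> of the sum of the characters in \<open>B\<close>. As \<open>K\<close> is
  nonnegative, that integral is at most \<open>L\<close> times the integral of \<open>K\<close>,
  which is \<open>card B\<close> by orthogonality.\<close>

lemma sum_coeff_differences_le:
  fixes f :: "real ^ 'n \<Rightarrow> complex"
  assumes f: "f \<in> borel_measurable cube_measure" and L: "AE x in cube_measure. cmod (f x) \<le> L"
    and B: "finite B" "\<And>l. l \<in> B \<Longrightarrow> int_vec l"
  shows "(\<Sum>l\<in>B. \<Sum>l'\<in>B. Re (fourier_coeff f (l' - l))) \<le> L * real (card B)"
proof -
  interpret finite_measure "cube_measure :: (real^'n) measure" by (rule finite_measure_cube)
  have i_char: "integrable cube_measure (torus_char k)" for k :: "real^'n"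
    by (rule integrable_const_bound[where B=1]) auto
  have i_f: "integrable cube_measure f" by (rule integrable_const_bound[OF L f])
  define K where "K x = (cmod (\<Sum>l\<in>B. torus_char l x))\<^sup>2" for x
  have K_eq: "complex_of_real (K x) = (\<Sum>l\<in>B. \<Sum>l'\<in>B. torus_char (l - l') x)" for x
    unfolding K_def by (rule dirichlet_square)
  have i_K: "integrable cube_measure (\<lambda>x. complex_of_real (K x))"
    unfolding K_eq by (intro Bochner_Integration.integrable_sum i_char)
  then have i_K': "integrable cube_measure K"
    by (simp add: complex_of_real_integrable_eq)
  have "complex_of_real (\<integral>x. K x \<partial>cube_measure) = (\<integral>x. complex_of_real (K x) \<partial>cube_measure)"
    by simp
  also have "\<dots> = (\<Sum>l\<in>B. \<Sum>l'\<in>B. (\<integral>x. torus_char (l - l') x \<partial>cube_measure))"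
    unfolding K_eq by (simp add: Bochner_Integration.integral_sum Bochner_Integration.integrable_sum i_char)
  also have "\<dots> = (\<Sum>l\<in>B. \<Sum>l'\<in>B. if l = l' then 1 else 0)"
    by (intro sum.cong refl) (simp add: integral_cube_char int_vec_arith B)
  also have "\<dots> = complex_of_real (real (card B))" using B(1) by simp
  finally have int_K: "(\<integral>x. K x \<partial>cube_measure) = real (card B)" using of_real_eq_iff by blast
  have fc: "fourier_coeff f (l' - l) = (\<integral>x. f x * torus_char (l - l') x \<partial>cube_measure)" for l l'
    unfolding fourier_coeff_eq by (simp flip: torus_char_minus_left)
  have i_fc: "integrable cube_measure (\<lambda>x. f x * torus_char (l - l') x)" for l l'
    by (rule integrable_mult_char[OF i_f])
  have fK_eq: "f x * complex_of_real (K x) = (\<Sum>l\<in>B. \<Sum>l'\<in>B. f x * torus_char (l - l') x)" for x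
    unfolding K_eq by (simp add: sum_distrib_left)
  have i_fK: "integrable cube_measure (\<lambda>x. f x * complex_of_real (K x))"
    unfolding fK_eq by (intro Bochner_Integration.integrable_sum i_fc)
  have "(\<Sum>l\<in>B. \<Sum>l'\<in>B. fourier_coeff f (l' - l)) = (\<integral>x. f x * complex_of_real (K x) \<partial>cube_measure)"
    unfolding fK_eq fc by (simp add: Bochner_Integration.integral_sum Bochner_Integration.integrable_sum i_fc)
  then have "(\<Sum>l\<in>B. \<Sum>l'\<in>B. Re (fourier_coeff f (l' - l))) = Re (\<integral>x. f x * complex_of_real (K x) \<partial>cube_measure)"
    by (simp flip: Re_sum)
  also have "\<dots> \<le> cmod (\<integral>x. f x * complex_of_real (K x) \<partial>cube_measure)" by (rule complex_Re_le_cmod)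
  also have "\<dots> \<le> (\<integral>x. cmod (f x * complex_of_real (K x)) \<partial>cube_measure)" by (rule integral_norm_bound)
  also have "\<dots> \<le> (\<integral>x. L * K x \<partial>cube_measure)"
  proof (rule integral_mono_AE)
    show "AE x in cube_measure. cmod (f x * complex_of_real (K x)) \<le> L * K x"
      using L
    proof eventually_elim
      case (elim x)
      have "K x \<ge> 0" by (simp add: K_def)
      with elim show ?case by (simp add: norm_mult mult_right_mono)
    qed
  qed (use i_fK i_K' in auto)
  also have "\<dots> = L * real (card B)" by (simp add: int_K)
  finally show ?thesis .
qed

text \<open>
  The squared Dirichlet kernel of a large box is a Fejer kernel; \<open>k\<close> occurs as a difference of
  points of the larger box at least as often as the smaller box has points.
\<close>

lemma sum_nonneg_coeffs_le:
  fixes f :: "real ^ 'n \<Rightarrow> complex"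
  assumes f: "f \<in> borel_measurable cube_measure" and L: "AE x in cube_measure. cmod (f x) \<le> L"
    and pos: "\<And>k. int_vec k \<Longrightarrow> Re (fourier_coeff f k) \<ge> 0"
    and S: "finite S" "\<And>k. k \<in> S \<Longrightarrow> int_vec k"
  shows "(\<Sum>k\<in>S. Re (fourier_coeff f k)) \<le> L"
proof -
  define c where "c k = Re (fourier_coeff f k)" for k
  obtain b where b: "\<And>k. k \<in> S \<Longrightarrow> norm k \<le> b" using finite_imp_bounded[OF S(1)] by (auto simp: bounded_iff)
  obtain M :: nat where M: "b \<le> real M" using real_arch_simple by blast
  have S_box: "k \<in> int_box M" if "k \<in> S" for k
    using S(2)[OF that] b[OF that] M component_le_norm_cart[of k] unfolding int_box_def
    by (auto intro: order_trans)
  have le: "(\<Sum>k\<in>S. c k) \<le> L * (1 + 2 * real M * inverse (real (Suc (2 * N)))) ^ CARD('n)" for N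
  proof -
    \<comment> \<open>The margin \<open>M\<close> bounds the entries of all vectors in
      \<open>S\<close>, so translates of \<open>S\<close> by points of \<open>?I\<close> stay inside
      \<open>?B\<close>.\<close>
    let ?B = "int_box (N + M) :: (real^'n) set" and ?I = "int_box N :: (real^'n) set"
    have sub: "(+) l ` S \<subseteq> ?B" if l: "l \<in> ?I" for l
    proof clarify
      fix k assume k: "k \<in> S"
      have "\<bar>l $ i + k $ i\<bar> \<le> real N + real M" for i
        using l S_box[OF k] abs_triangle_ineq[of "l $ i" "k $ i"] unfolding int_box_def
        by (smt (verit) mem_Collect_eq)
      then show "l + k \<in> ?B" using l S_box[OF k] by (auto simp: int_box_def int_vec_arith)
    qed
    have IB: "?I \<subseteq> ?B" by (auto simp: int_box_def intro: order_trans)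
    have nn: "c (l' - l) \<ge> 0" if "l \<in> ?B" "l' \<in> ?B" for l l'
      using that unfolding c_def by (intro pos int_vec_arith) (auto simp: int_box_def)
    have "real (card ?I) * (\<Sum>k\<in>S. c k) = (\<Sum>l\<in>?I. \<Sum>k\<in>S. c k)" by simp
    also have "\<dots> = (\<Sum>l\<in>?I. \<Sum>l'\<in>(+) l ` S. c (l' - l))"
      by (simp add: sum.reindex)
    \<comment> \<open>Nonnegativity of the coefficients permits enlarging both sums to the full
      box.\<close>
    also have "\<dots> \<le> (\<Sum>l\<in>?I. \<Sum>l'\<in>?B. c (l' - l))"
      by (intro sum_mono sum_mono2 sub finite_int_box) (use IB nn in auto)
    also have "\<dots> \<le> (\<Sum>l\<in>?B. \<Sum>l'\<in>?B. c (l' - l))"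
      by (intro sum_mono2 IB finite_int_box sum_nonneg) (use nn in auto)
    also have "\<dots> \<le> L * real (card ?B)"
      unfolding c_def by (rule sum_coeff_differences_le[OF f L finite_int_box]) (auto simp: int_box_def)
    finally have "(\<Sum>k\<in>S. c k) \<le> L * (real (card ?B) / real (card ?I))"
      by (simp add: card_int_box field_simps)
    also have "real (card ?B) / real (card ?I) = (real (2 * (N + M) + 1) / real (2 * N + 1)) ^ CARD('n)"
      unfolding card_int_box of_nat_power power_divide ..
    also have "real (2 * (N + M) + 1) / real (2 * N + 1) = 1 + 2 * real M * inverse (real (Suc (2 * N)))"
      by (simp add: field_simps)
    finally show ?thesis .
  qed
  \<comment> \<open>With \<open>M\<close> fixed, the ratio of the box sizes tends to 1, so the loss
    from the boundary layer disappears in the limit.\<close>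
  have "(\<lambda>N. inverse (real (Suc (2 * N)))) \<longlonglongrightarrow> 0"
    using LIMSEQ_subseq_LIMSEQ[OF LIMSEQ_inverse_real_of_nat, of "\<lambda>N. 2 * N"]
    by (simp add: strict_mono_def o_def)
  then have "(\<lambda>N. L * (1 + 2 * real M * inverse (real (Suc (2 * N)))) ^ CARD('n))
      \<longlonglongrightarrow> L * (1 + 2 * real M * 0) ^ CARD('n)"
    by (intro tendsto_intros)
  then show ?thesis
    using LIMSEQ_le_const[of _ _ "\<Sum>k\<in>S. c k"] le unfolding c_def by fastforce
qed

section \<open>Absolutely convergent Fourier series\<close>

text \<open>Sum and integral are exchanged because the L1 norms of the terms are dominated by
  \<open>cmod (a n)\<close> times the L1 norm of \<open>\<phi>\<close>. It serves with a general
  \<open>\<phi>\<close> for convolutions, with a conjugate character for coefficients and with the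
  constant 1 for means.\<close>

lemma sums_integral_mult_series:
  fixes a :: "nat \<Rightarrow> complex" and g :: "nat \<Rightarrow> 'a \<Rightarrow> complex"
  assumes \<phi>: "integrable M \<phi>" and a: "summable (\<lambda>n. cmod (a n))"
    and g: "\<And>n. g n \<in> borel_measurable M" "\<And>n x. cmod (g n x) \<le> 1"
  shows "(\<lambda>n. a n * (\<integral>x. \<phi> x * g n x \<partial>M)) sums (\<integral>x. \<phi> x * (\<Sum>n. a n * g n x) \<partial>M)"
proof -
  have i: "integrable M (\<lambda>x. \<phi> x * g n x)" for n
    by (rule integrable_mult_bounded[OF \<phi> g(1), where B=1]) (simp add: g(2))
  have s: "summable (\<lambda>n. cmod (a n * g n x))" for x
    by (rule summable_comparison_test_ev[OF _ a], rule always_eventually)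
       (auto simp: norm_mult intro!: mult_left_le g(2))
  have bound: "cmod (\<phi> x * (a n * g n x)) \<le> cmod (a n) * cmod (\<phi> x)" for n x
    using mult_left_mono[OF g(2)[of n x], of "cmod (a n) * cmod (\<phi> x)"]
    by (simp add: norm_mult mult_ac)
  have "(\<lambda>n. (\<integral>x. \<phi> x * (a n * g n x) \<partial>M)) sums (\<integral>x. (\<Sum>n. \<phi> x * (a n * g n x)) \<partial>M)"
  proof (rule sums_integral)
    show i': "integrable M (\<lambda>x. \<phi> x * (a n * g n x))" for n
      using Bochner_Integration.integrable_mult_right[OF i[of n], of "a n"] by (simp add: mult_ac)
    show "AE x in M. summable (\<lambda>n. norm (\<phi> x * (a n * g n x)))"
      by (rule AE_I2) (subst norm_mult, rule summable_mult, rule s)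
    show "summable (\<lambda>n. \<integral>x. norm (\<phi> x * (a n * g n x)) \<partial>M)"
    proof (rule summable_comparison_test_ev)
      show "summable (\<lambda>n. cmod (a n) * (\<integral>x. cmod (\<phi> x) \<partial>M))" using a by (rule summable_mult2)
      have "(\<integral>x. norm (\<phi> x * (a n * g n x)) \<partial>M) \<le> (\<integral>x. cmod (a n) * cmod (\<phi> x) \<partial>M)" for n
        by (rule integral_mono) (use i' \<phi> bound in auto)
      then show "\<forall>\<^sub>F n in sequentially. norm (\<integral>x. norm (\<phi> x * (a n * g n x)) \<partial>M)
          \<le> cmod (a n) * (\<integral>x. cmod (\<phi> x) \<partial>M)"
        by (intro always_eventually) simp
    qed
  qed
  moreover have "(\<Sum>n. \<phi> x * (a n * g n x)) = \<phi> x * (\<Sum>n. a n * g n x)" for x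
    by (rule suminf_mult[OF summable_norm_cancel[OF s]])
  moreover have "(\<integral>x. \<phi> x * (a n * g n x) \<partial>M) = a n * (\<integral>x. \<phi> x * g n x \<partial>M)" for n
    by (subst integral_mult_right_zero[symmetric]) (simp add: mult_ac)
  ultimately show ?thesis by simp
qed

lemma int_vec_enumeration:
  obtains \<kappa> :: "nat \<Rightarrow> real ^ 'n" where "inj \<kappa>" "range \<kappa> = {k. int_vec k}"
proof -
  have "{k :: real^'n. int_vec k} \<subseteq> (\<Union>N. int_box N)"
  proof clarify
    fix k :: "real^'n" assume k: "int_vec k"
    obtain N where "norm k \<le> real N" using real_arch_simple by blast
    then have "k \<in> int_box N" using k component_le_norm_cart[of k]
      unfolding int_box_def by (auto intro: order_trans)
    then show "k \<in> (\<Union>N. int_box N)" by blast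
  qed
  then have c: "countable {k :: real^'n. int_vec k}"
    by (rule countable_subset) (auto intro: countable_finite finite_int_box)
  \<comment> \<open>Diagonal vectors witness that there are infinitely many integer vectors, as a
    bijection with \<open>nat\<close> requires.\<close>
  have "inj (\<lambda>n::nat. (\<chi> i. real n) :: real^'n)" by (auto intro!: injI simp: vec_eq_iff)
  then have "infinite (range (\<lambda>n::nat. (\<chi> i. real n) :: real^'n))"
    by (rule range_inj_infinite)
  then have "infinite {k :: real^'n. int_vec k}"
    by (rule infinite_super[rotated]) (auto simp: int_vec_def)
  with c have "bij_betw (from_nat_into {k :: real^'n. int_vec k}) UNIV {k. int_vec k}"
    by (rule bij_betw_from_nat_into)
  then show ?thesis using that unfolding bij_betw_def by blast
qed

text \<open>Frequencies are listed as a sequence so that \<open>sums\<close> over \<open>nat\<close>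
  applies. Injectivity of \<open>\<kappa>\<close> ensures that no two terms share a frequency, so
  that \<open>a n\<close> really is a Fourier coefficient of the series.\<close>

locale positive_fourier_series =
  fixes \<kappa> :: "nat \<Rightarrow> real ^ 'n" and a :: "nat \<Rightarrow> real"
  assumes inj: "inj \<kappa>" and int_vec_freq: "\<And>n. int_vec (\<kappa> n)"
    and nonneg: "\<And>n. a n \<ge> 0" and summable: "summable a"
begin

definition series :: "real ^ 'n \<Rightarrow> complex" where
  "series x = (\<Sum>n. of_real (a n) * torus_char (\<kappa> n) x)"

lemma summable_cmod: "summable (\<lambda>n. cmod (complex_of_real (a n)))"
  using summable nonneg by simp

lemma summable_weighted:
  fixes w :: "nat \<Rightarrow> complex"
  assumes "\<And>n. cmod (w n) \<le> B"
  shows "summable (\<lambda>n. of_real (a n) * w n)"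
proof (rule summable_comparison_test_ev)
  show "summable (\<lambda>n. a n * B)" by (rule summable_mult2[OF summable])
  show "\<forall>\<^sub>F n in sequentially. norm (complex_of_real (a n) * w n) \<le> a n * B"
    using assms nonneg by (intro always_eventually) (simp add: norm_mult mult_left_mono)
qed

lemma series_sums: "(\<lambda>n. of_real (a n) * torus_char (\<kappa> n) x) sums series x"
  unfolding series_def by (intro summable_sums summable_weighted[of _ 1]) simp

lemma series_measurable [measurable]: "series \<in> borel_measurable borel"
  unfolding series_def by measurable

lemma cmod_series_le: "cmod (series x) \<le> suminf a"
proof -
  have "cmod (series x) \<le> (\<Sum>n. cmod (of_real (a n) * torus_char (\<kappa> n) x))"
    unfolding series_def by (rule summable_norm) (use summable nonneg in \<open>simp add: norm_mult\<close>)
  then show ?thesis using nonneg by (simp add: norm_mult)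
qed

lemma one_periodic_series: "one_periodic series"
  unfolding one_periodic_def series_def using int_vec_freq by (simp add: torus_char_periodic)

lemma convolution_series_sums:
  assumes "integrable cube_measure \<phi>"
  shows "(\<lambda>n. of_real (a n) * fourier_coeff \<phi> (\<kappa> n) * torus_char (\<kappa> n) x)
     sums (\<integral>y. series (x - y) * \<phi> y \<partial>cube_measure)"
proof -
  have "(\<lambda>n. of_real (a n) * (\<integral>y. \<phi> y * torus_char (\<kappa> n) (x - y) \<partial>cube_measure))
     sums (\<integral>y. \<phi> y * (\<Sum>n. of_real (a n) * torus_char (\<kappa> n) (x - y)) \<partial>cube_measure)"
    by (rule sums_integral_mult_series[OF assms summable_cmod])
       (auto intro!: borel_measurable_cubeI)
  moreover have "(\<integral>y. \<phi> y * torus_char (\<kappa> n) (x - y) \<partial>cube_measure)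
      = fourier_coeff \<phi> (\<kappa> n) * torus_char (\<kappa> n) x" for n
    unfolding fourier_coeff_eq torus_char_diff_right
    by (subst integral_mult_left_zero[symmetric]) (simp add: mult_ac)
  ultimately show ?thesis by (simp add: series_def mult_ac)
qed

lemma fourier_coeff_series: "fourier_coeff series (\<kappa> m) = of_real (a m)"
proof -
  interpret finite_measure "cube_measure :: (real^'n) measure" by (rule finite_measure_cube)
  have "integrable cube_measure (\<lambda>x. cnj (torus_char (\<kappa> m) x))"
    using integrable_mult_char(2)[of "\<lambda>_. 1" "\<kappa> m"] by simp
  then have "(\<lambda>n. of_real (a n) * (\<integral>x. cnj (torus_char (\<kappa> m) x) * torus_char (\<kappa> n) x \<partial>cube_measure))
     sums (\<integral>x. cnj (torus_char (\<kappa> m) x) * (\<Sum>n. of_real (a n) * torus_char (\<kappa> n) x) \<partial>cube_measure)"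
    by (rule sums_integral_mult_series[OF _ summable_cmod]) auto
  moreover have "(\<integral>x. cnj (torus_char (\<kappa> m) x) * torus_char (\<kappa> n) x \<partial>cube_measure) = (if n = m then 1 else 0)" for n
    using integral_cube_char[of "\<kappa> n - \<kappa> m"] inj
    by (simp add: torus_char_diff_left mult.commute int_vec_arith int_vec_freq inj_eq)
  then have "(\<lambda>n. of_real (a n) * (\<integral>x. cnj (torus_char (\<kappa> m) x) * torus_char (\<kappa> n) x \<partial>cube_measure)) =
      (\<lambda>n. if n = m then complex_of_real (a n) else 0)"
    by (simp add: fun_eq_iff)
  ultimately have "(\<lambda>n. if n = m then complex_of_real (a n) else 0) sums
     (\<integral>x. cnj (torus_char (\<kappa> m) x) * (\<Sum>n. of_real (a n) * torus_char (\<kappa> n) x) \<partial>cube_measure)"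
    by (simp only:)
  also have "(\<integral>x. cnj (torus_char (\<kappa> m) x) * (\<Sum>n. of_real (a n) * torus_char (\<kappa> n) x) \<partial>cube_measure)
      = fourier_coeff series (\<kappa> m)"
    unfolding fourier_coeff_eq series_def by (simp only: mult.commute)
  finally have "(\<lambda>n. if n = m then complex_of_real (a n) else 0) sums fourier_coeff series (\<kappa> m)" .
  then show ?thesis
    using sums_single[of m "\<lambda>n. complex_of_real (a n)"] sums_unique2 by blast
qed

lemma integrable_series_translate: "integrable cube_measure (\<lambda>x. series (x - t))"
  by (rule finite_measure.integrable_const_bound[OF finite_measure_cube, where B="suminf a"])
     (auto intro!: borel_measurable_cubeI cmod_series_le)

text \<open>Only frequency 0 survives integration, and its weight is 0. The factor \<open>w\<close>
  covers two cases: translates of the series, with conjugate characters as \<open>w\<close>, and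
  convolutions, with the coefficients of \<open>\<phi>\<close>.\<close>

lemma integral_weighted_chars:
  fixes w :: "nat \<Rightarrow> complex"
  assumes zero: "\<And>n. \<kappa> n = 0 \<Longrightarrow> a n = 0" and w: "\<And>n. cmod (w n) \<le> B"
  shows "(\<integral>x. (\<Sum>n. of_real (a n) * w n * torus_char (\<kappa> n) x) \<partial>cube_measure) = 0"
proof -
  interpret finite_measure "cube_measure :: (real^'n) measure" by (rule finite_measure_cube)
  have "summable (\<lambda>n. cmod (of_real (a n) * w n))"
  proof (rule summable_comparison_test_ev)
    show "summable (\<lambda>n. a n * B)" by (rule summable_mult2[OF summable])
    show "\<forall>\<^sub>F n in sequentially. norm (cmod (complex_of_real (a n) * w n)) \<le> a n * B"
      using w nonneg by (intro always_eventually) (simp add: norm_mult mult_left_mono)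
  qed
  then have "(\<lambda>n. of_real (a n) * w n * (\<integral>x. 1 * torus_char (\<kappa> n) x \<partial>cube_measure)) sums
     (\<integral>x. 1 * (\<Sum>n. of_real (a n) * w n * torus_char (\<kappa> n) x) \<partial>cube_measure)"
    by (intro sums_integral_mult_series) auto
  moreover have "(\<lambda>n. of_real (a n) * w n * (\<integral>x. 1 * torus_char (\<kappa> n) x \<partial>cube_measure)) = (\<lambda>n. 0)"
    using zero by (auto simp: fun_eq_iff integral_cube_char int_vec_freq)
  ultimately have "(\<lambda>n. 0) sums (\<integral>x. (\<Sum>n. of_real (a n) * w n * torus_char (\<kappa> n) x) \<partial>cube_measure)"
    by (simp only: mult_1_left)
  then show ?thesis using sums_unique2[OF _ sums_zero] by blast
qed
end

section \<open>Almost everywhere equality and measurability under translation and reflection\<close>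

lemma AE_cube_iff: "(AE x in cube_measure. P x) \<longleftrightarrow> (AE x in lebesgue. x \<in> unit_cube \<longrightarrow> P x)"
  by (rule AE_restrict_space_iff) simp

text \<open>Every point is an integer translate of a point of the cube, so countably many translates
  of the exceptional null set cover all disagreements.\<close>

lemma negligible_periodic_neq:
  fixes f g :: "real ^ 'n \<Rightarrow> complex"
  assumes per: "one_periodic f" "one_periodic g" and eq: "AE x in cube_measure. f x = g x"
  shows "negligible {x. f x \<noteq> g x}"
proof -
  obtain N where N: "negligible N" "{x. \<not> (x \<in> unit_cube \<longrightarrow> f x = g x)} \<subseteq> N"
    using eq unfolding AE_cube_iff eventually_ae_filter_negligible by blast
  obtain \<kappa> :: "nat \<Rightarrow> real ^ 'n" where \<kappa>: "range \<kappa> = {k. int_vec k}"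
    using int_vec_enumeration by blast
  have "{x. f x \<noteq> g x} \<subseteq> (\<Union>n. (+) (\<kappa> n) ` N)"
  proof clarify
    fix x assume x: "f x \<noteq> g x"
    define k :: "real^'n" where "k = (\<chi> i. of_int \<lfloor>x $ i\<rfloor>)"
    have k: "int_vec k" by (simp add: k_def int_vec_def)
    then obtain n where n: "k = \<kappa> n" using \<kappa> by blast
    have "x - k \<in> unit_cube" by (auto simp: unit_cube_def k_def) linarith
    moreover have "f (x - k) = f x" "g (x - k) = g x"
      using per k unfolding one_periodic_def by (metis diff_add_cancel)+
    ultimately have "x - k \<in> N" using N(2) x by auto
    then have "x \<in> (+) (\<kappa> n) ` N" using n by (intro image_eqI[of _ _ "x - k"]) auto
    then show "x \<in> (\<Union>n. (+) (\<kappa> n) ` N)" by blast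
  qed
  moreover have "negligible (\<Union>n. (+) (\<kappa> n) ` N)"
    by (rule negligible_countable_Union) (auto intro: negligible_translation N(1))
  ultimately show ?thesis using negligible_subset by blast
qed

text \<open>The reflected form is for the integration variable of a convolution, the other one for
  the choice of a new search point.\<close>

lemma AE_cube_translates:
  fixes f g :: "real ^ 'n \<Rightarrow> complex"
  assumes "one_periodic f" "one_periodic g" "AE x in cube_measure. f x = g x"
  shows "AE y in cube_measure. f (x - y) = g (x - y)" "AE y in cube_measure. f (y - x) = g (y - x)"
proof -
  let ?N = "{x. f x \<noteq> g x}"
  have N: "negligible ?N" by (rule negligible_periodic_neq[OF assms])
  have "negligible ((\<lambda>z. x - z) ` ?N)" "negligible ((\<lambda>z. z + x) ` ?N)"
    by (intro negligible_differentiable_image_negligible N differentiable_on_diff differentiable_on_add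
        differentiable_on_const differentiable_on_ident order_refl)+
  moreover have "{y. \<not> f (x - y) = g (x - y)} \<subseteq> (\<lambda>z. x - z) ` ?N"
    by (auto intro!: image_eqI[where x="x - y" for y])
  moreover have "{y. \<not> f (y - x) = g (y - x)} \<subseteq> (\<lambda>z. z + x) ` ?N"
    by (auto intro!: image_eqI[where x="y - x" for y])
  ultimately have "AE y in lebesgue. f (x - y) = g (x - y)" "AE y in lebesgue. f (y - x) = g (y - x)"
    unfolding eventually_ae_filter_negligible by blast+
  then show "AE y in cube_measure. f (x - y) = g (x - y)" "AE y in cube_measure. f (y - x) = g (y - x)"
    unfolding AE_cube_iff by auto
qed

text \<open>Composition with a continuous map can destroy Lebesgue measurability; the affine
  bijection \<open>y \<mapsto> x - y\<close>, with scaling factor -1 in each coordinate, preserves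
  it.\<close>

lemma measurable_reflect_translate:
  fixes F :: "real ^ 'n \<Rightarrow> complex"
  assumes "F \<in> borel_measurable lebesgue"
  shows "(\<lambda>y. F (x - y)) \<in> borel_measurable cube_measure"
proof -
  have "(\<lambda>y::real^'n. x + (\<Sum>j\<in>Basis. (- 1 * (y \<bullet> j)) *\<^sub>R j)) \<in> lebesgue \<rightarrow>\<^sub>M lebesgue"
    by (rule lebesgue_affine_measurable) simp
  moreover have "x + (\<Sum>j\<in>Basis. (- 1 * (y \<bullet> j)) *\<^sub>R j) = x - y" for y
    by (simp add: sum_negf euclidean_representation)
  ultimately have "(\<lambda>y. x - y) \<in> lebesgue \<rightarrow>\<^sub>M lebesgue" by simp
  from measurable_compose[OF this assms] show ?thesis
    by (rule measurable_restrict_space1)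
qed

section \<open>Choice of the points and the energy estimate\<close>

context positive_fourier_series
begin

definition char_sum :: "(nat \<Rightarrow> real ^ 'n) \<Rightarrow> nat \<Rightarrow> nat \<Rightarrow> complex" where
  "char_sum \<xi> m n = (\<Sum>j=1..m. torus_char (\<kappa> n) (\<xi> j))"

text \<open>\<open>f\<close> stands for the given pointwise representative. The points are found one
  at a time; for \<open>n = 1\<close> the sums are empty, so the initial point only has to lie in
  the cube.\<close>

lemma averaging_points_exist:
  fixes m :: nat
  assumes zero: "\<And>n. \<kappa> n = 0 \<Longrightarrow> a n = 0"
    and per: "one_periodic f" and eq: "AE x in cube_measure. f x = series x"
  shows "\<exists>\<xi>. \<forall>n\<in>{1..m}. \<xi> n \<in> unit_cube \<and>
     (\<Sum>j=1..n-1. Re (series (\<xi> n - \<xi> j))) \<le> 0 \<and>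
     (\<forall>j\<in>{1..n-1}. f (\<xi> n - \<xi> j) = series (\<xi> n - \<xi> j))"
proof (induction m)
  case (Suc m)
  then obtain \<xi> where \<xi>: "\<And>n. n \<in> {1..m} \<Longrightarrow> \<xi> n \<in> unit_cube \<and>
     (\<Sum>j=1..n-1. Re (series (\<xi> n - \<xi> j))) \<le> 0 \<and>
     (\<forall>j\<in>{1..n-1}. f (\<xi> n - \<xi> j) = series (\<xi> n - \<xi> j))" by blast
  define g where "g x = (\<Sum>j=1..m. Re (series (x - \<xi> j)))" for x
  have i_g: "integrable cube_measure g"
    unfolding g_def by (intro Bochner_Integration.integrable_sum integrable_Re integrable_series_translate)
  have zero_t: "(\<integral>x. series (x - t) \<partial>cube_measure) = 0" for t
    using integral_weighted_chars[OF zero, of "\<lambda>n. cnj (torus_char (\<kappa> n) t)" 1]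
    by (simp add: series_def torus_char_diff_right mult_ac)
  have "(\<integral>x. g x \<partial>cube_measure) = 0"
    unfolding g_def using integrable_series_translate
    by (simp add: Bochner_Integration.integral_sum zero_t)
  have ex: "\<exists>x\<in>unit_cube. g x \<le> 0 \<and> (\<forall>j\<in>{1..m}. f (x - \<xi> j) = series (x - \<xi> j))"
  \<comment> \<open>Otherwise \<open>g\<close> is positive off the null set of disagreements. With
    integral 0 it would also vanish almost everywhere, which is impossible on a cube of measure
    1.\<close>
  proof (rule ccontr)
    assume neg: "\<not> ?thesis"
    have "AE x in cube_measure. \<forall>j\<in>{1..m}. f (x - \<xi> j) = series (x - \<xi> j)"
      by (rule AE_finite_allI) (auto intro: AE_cube_translates(2)[OF per one_periodic_series eq])
    then have pos: "AE x in cube_measure. g x > 0"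
      using AE_space by eventually_elim (use neg in \<open>force simp: not_le\<close>)
    then have "AE x in cube_measure. 0 \<le> g x" by eventually_elim simp
    then have "AE x in cube_measure. g x = 0"
      using integral_nonneg_eq_0_iff_AE[OF i_g] \<open>(\<integral>x. g x \<partial>cube_measure) = 0\<close>
      by blast
    with pos have "AE x in (cube_measure :: (real^'n) measure). False" by eventually_elim simp
    then have "emeasure cube_measure (space (cube_measure :: (real^'n) measure)) = 0"
      unfolding ae_filter_eq_bot_iff[symmetric] eventually_False .
    then show False by (simp add: emeasure_restrict_space emeasure_unit_cube)
  qed
  then obtain x where x: "x \<in> unit_cube" "g x \<le> 0" "\<forall>j\<in>{1..m}. f (x - \<xi> j) = series (x - \<xi> j)" by blast
  define \<eta> where "\<eta> = \<xi>(Suc m := x)"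
  have old: "\<eta> n = \<xi> n" if "n \<in> {1..m}" for n using that by (simp add: \<eta>_def)
  have new: "\<eta> (Suc m) = x" by (simp add: \<eta>_def)
  have sum_old: "(\<Sum>j=1..n-1. Re (series (y - \<eta> j))) = (\<Sum>j=1..n-1. Re (series (y - \<xi> j)))"
    if "n \<in> {1..Suc m}" for n y
    using that by (intro sum.cong refl) (auto simp: \<eta>_def)
  show ?case
  proof (intro exI[of _ \<eta>] ballI)
    fix n assume n: "n \<in> {1..Suc m}"
    show "\<eta> n \<in> unit_cube \<and> (\<Sum>j=1..n-1. Re (series (\<eta> n - \<eta> j))) \<le> 0 \<and>
       (\<forall>j\<in>{1..n-1}. f (\<eta> n - \<eta> j) = series (\<eta> n - \<eta> j))"
    proof (cases "n = Suc m")
      case True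
      then show ?thesis unfolding sum_old[OF n] using x by (simp add: new old g_def)
    next
      case False
      then have n': "n \<in> {1..m}" using n by auto
      then show ?thesis unfolding sum_old[OF n] using \<xi>[OF n'] n' by (auto simp: old)
    qed
  qed
qed simp

text \<open>With \<open>u\<close> the old character sum and \<open>v\<close> the new unimodular
  term, the squared modulus of \<open>u + v\<close> grows by \<open>1 + 2 * Re (v * cnj u)\<close>.
  Weighted by \<open>a n\<close> and summed, the cross terms give twice the search sum, which is
  nonpositive. The value \<open>e\<close> is existential so that convergence is carried through the
  induction along with the bound.\<close>

lemma char_sum_energy:
  assumes "\<forall>n\<in>{1..m}. (\<Sum>j=1..n-1. Re (series (\<xi> n - \<xi> j))) \<le> 0"
  shows "\<exists>e. (\<lambda>n. a n * (cmod (char_sum \<xi> m n))\<^sup>2) sums e \<and> e \<le> real m * suminf a"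
  using assms
proof (induction m)
  case 0
  then show ?case by (auto simp: char_sum_def)
next
  case (Suc m)
  then obtain e where e: "(\<lambda>n. a n * (cmod (char_sum \<xi> m n))\<^sup>2) sums e" "e \<le> real m * suminf a"
    by auto
  let ?r = "\<Sum>j=1..m. Re (series (\<xi> (Suc m) - \<xi> j))"
  have r: "?r \<le> 0" using Suc.prems by (auto dest: bspec[of _ _ "Suc m"])
  have "(\<lambda>n. \<Sum>j=1..m. Re (of_real (a n) * torus_char (\<kappa> n) (\<xi> (Suc m) - \<xi> j))) sums ?r"
    by (intro sums_sum sums_Re series_sums)
  then have s: "(\<lambda>n. a n * (cmod (char_sum \<xi> m n))\<^sup>2 + (a n + 2 * (\<Sum>j=1..m. Re (of_real (a n) * torus_char (\<kappa> n) (\<xi> (Suc m) - \<xi> j)))))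
      sums (e + (suminf a + 2 * ?r))"
    by (intro sums_add sums_mult e summable_sums summable)
  have "a n * (cmod (char_sum \<xi> m n))\<^sup>2 + (a n + 2 * (\<Sum>j=1..m. Re (of_real (a n) * torus_char (\<kappa> n) (\<xi> (Suc m) - \<xi> j))))
     = a n * (cmod (char_sum \<xi> (Suc m) n))\<^sup>2" for n
  proof -
    define u where "u = char_sum \<xi> m n"
    define v where "v = torus_char (\<kappa> n) (\<xi> (Suc m))"
    have v: "(cmod v)\<^sup>2 = 1" by (simp add: v_def)
    have suc: "char_sum \<xi> (Suc m) n = u + v" by (simp add: u_def v_def char_sum_def)
    have "(\<Sum>j=1..m. Re (of_real (a n) * torus_char (\<kappa> n) (\<xi> (Suc m) - \<xi> j))) = a n * Re (v * cnj u)"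
      unfolding u_def v_def char_sum_def
      by (simp add: torus_char_diff_right sum_distrib_left)
    moreover have "(cmod (u + v))\<^sup>2 = (cmod u)\<^sup>2 + (cmod v)\<^sup>2 + 2 * Re (v * cnj u)"
      by (simp add: cmod_power2) algebra
    ultimately show ?thesis unfolding suc v by (simp add: u_def algebra_simps)
  qed
  with s have "(\<lambda>n. a n * (cmod (char_sum \<xi> (Suc m) n))\<^sup>2) sums (e + (suminf a + 2 * ?r))" by simp
  moreover have "e + (suminf a + 2 * ?r) \<le> real (Suc m) * suminf a"
    using e(2) r by (simp add: algebra_simps)
  ultimately show ?case by blast
qed

text \<open>Cauchy-Schwarz appears termwise as \<open>t \<le> (q + t\<^sup>2 / q) / 2\<close>, which
  yields summability at the same time.\<close>

lemma weighted_char_sum_le: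
  assumes m: "m \<ge> 1" and av: "\<forall>n\<in>{1..m}. (\<Sum>j=1..n-1. Re (series (\<xi> n - \<xi> j))) \<le> 0"
    and w: "\<And>n. cmod (w n) \<le> 1"
  shows "cmod (\<Sum>n. of_real (a n) * w n * char_sum \<xi> m n) \<le> sqrt (real m) * suminf a"
proof -
  obtain e where e: "(\<lambda>n. a n * (cmod (char_sum \<xi> m n))\<^sup>2) sums e" "e \<le> real m * suminf a"
    using char_sum_energy[OF av] by blast
  \<comment> \<open>This value balances the two halves: the energy bound
    \<open>real m * suminf a\<close> divided by \<open>q\<close> equals
    \<open>q * suminf a\<close>.\<close>
  define q where "q = sqrt (real m)"
  have q: "q > 0" "q\<^sup>2 = real m" using m by (simp_all add: q_def)
  have s: "(\<lambda>n. (q * a n + a n * (cmod (char_sum \<xi> m n))\<^sup>2 / q) / 2) sums ((q * suminf a + e / q) / 2)"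
    by (intro sums_divide sums_add sums_mult e summable_sums summable)
  have le: "cmod (of_real (a n) * w n * char_sum \<xi> m n) \<le> (q * a n + a n * (cmod (char_sum \<xi> m n))\<^sup>2 / q) / 2" for n
  proof -
    let ?t = "cmod (char_sum \<xi> m n)"
    have "2 * q * ?t \<le> q\<^sup>2 + ?t\<^sup>2" using sum_squares_bound[of q ?t] by simp
    then have "?t \<le> (q + ?t\<^sup>2 / q) / 2" using q(1) by (simp add: field_simps power2_eq_square)
    then have "a n * ?t \<le> a n * ((q + ?t\<^sup>2 / q) / 2)" using nonneg by (intro mult_left_mono)
    moreover have "a n * cmod (w n) * ?t \<le> a n * ?t"
      using w[of n] nonneg[of n] by (intro mult_right_mono) (auto intro: mult_left_le)
    ultimately show ?thesis using nonneg[of n] by (simp add: norm_mult algebra_simps)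
  qed
  have sm: "summable (\<lambda>n. cmod (of_real (a n) * w n * char_sum \<xi> m n))"
    by (rule summable_comparison_test_ev[OF _ sums_summable[OF s]]) (use le in auto)
  have "cmod (\<Sum>n. of_real (a n) * w n * char_sum \<xi> m n) \<le> (\<Sum>n. cmod (of_real (a n) * w n * char_sum \<xi> m n))"
    by (rule summable_norm[OF sm])
  also have "\<dots> \<le> (q * suminf a + e / q) / 2"
    using suminf_le[OF le sm sums_summable[OF s]] sums_unique[OF s] by simp
  also have "\<dots> \<le> (q * suminf a + real m * suminf a / q) / 2"
    using q(1) e(2) by (simp add: divide_right_mono)
  also have "\<dots> = q * suminf a" using q by (simp add: field_simps power2_eq_square flip: q(2))
  finally show ?thesis by (simp add: q_def)
qed

text \<open>Convolution multiplies the weights \<open>a n\<close> by the coefficients of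
  \<open>\<phi>\<close>, which are at most 1 in modulus by the L1 bound. All three claims then
  concern a series with weights \<open>a n * w n\<close>.\<close>

lemma convolution_series:
  assumes \<phi>: "integrable cube_measure \<phi>" "(\<integral>y. cmod (\<phi> y) \<partial>cube_measure) \<le> 1"
    and zero: "\<And>n. \<kappa> n = 0 \<Longrightarrow> a n = 0"
  defines "h \<equiv> (\<lambda>x. \<integral>y. series (x - y) * \<phi> y \<partial>cube_measure)"
  shows "integrable cube_measure h" "(\<integral>x. h x \<partial>cube_measure) = 0"
    "\<And>m \<xi>. m \<ge> 1 \<Longrightarrow> \<forall>n\<in>{1..m}. (\<Sum>j=1..n-1. Re (series (\<xi> n - \<xi> j))) \<le> 0 \<Longrightarrow>
       cmod (\<Sum>j=1..m. h (\<xi> j)) \<le> sqrt (real m) * suminf a"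
proof -
  define w where "w n = fourier_coeff \<phi> (\<kappa> n)" for n
  have w: "cmod (w n) \<le> 1" for n
  proof -
    have "cmod (w n) \<le> (\<integral>y. cmod (\<phi> y * cnj (torus_char (\<kappa> n) y)) \<partial>cube_measure)"
      unfolding w_def fourier_coeff_eq by (rule integral_norm_bound)
    then show ?thesis using \<phi>(2) by (simp add: norm_mult)
  qed
  have h_sums: "(\<lambda>n. of_real (a n) * w n * torus_char (\<kappa> n) x) sums h x" for x
    unfolding h_def w_def by (rule convolution_series_sums[OF \<phi>(1)])
  have h_eq: "h = (\<lambda>x. \<Sum>n. of_real (a n) * w n * torus_char (\<kappa> n) x)"
    using sums_unique[OF h_sums] by blast
  have h_bound: "cmod (h x) \<le> suminf a" for x
  proof -
    have le: "cmod (of_real (a n) * w n * torus_char (\<kappa> n) x) \<le> a n" for n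
      using w[of n] nonneg[of n] by (simp add: norm_mult mult_left_le)
    then have sm: "summable (\<lambda>n. cmod (of_real (a n) * w n * torus_char (\<kappa> n) x))"
      by (intro summable_comparison_test_ev[OF _ summable] always_eventually) simp
    show ?thesis
      unfolding h_eq using summable_norm[OF sm] suminf_le[OF le sm summable] by simp
  qed
  have h_meas: "h \<in> borel_measurable cube_measure"
    unfolding h_eq by measurable
  show "integrable cube_measure h"
    by (rule finite_measure.integrable_const_bound[OF finite_measure_cube, where B="suminf a"])
       (use h_bound h_meas in auto)
  show "(\<integral>x. h x \<partial>cube_measure) = 0"
    unfolding h_eq by (rule integral_weighted_chars[OF zero w])
  fix m :: nat and \<xi> :: "nat \<Rightarrow> real^'n"
  assume m: "m \<ge> 1" and av: "\<forall>n\<in>{1..m}. (\<Sum>j=1..n-1. Re (series (\<xi> n - \<xi> j))) \<le> 0"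
  have "(\<lambda>n. \<Sum>j=1..m. of_real (a n) * w n * torus_char (\<kappa> n) (\<xi> j)) sums (\<Sum>j=1..m. h (\<xi> j))"
    by (intro sums_sum h_sums)
  then have "(\<Sum>j=1..m. h (\<xi> j)) = (\<Sum>n. of_real (a n) * w n * char_sum \<xi> m n)"
    by (simp add: char_sum_def sum_distrib_left sums_iff)
  then show "cmod (\<Sum>j=1..m. h (\<xi> j)) \<le> sqrt (real m) * suminf a"
    using weighted_char_sum_le[OF m av w] by simp
qed

end

section \<open>From the function to its series, and the error bound\<close>

text \<open>The norm is an extended real; minus infinity is excluded because the cube has positive
  measure.\<close>

lemma Linf_norm_finite:
  fixes G :: "real ^ 'n \<Rightarrow> complex"
  assumes G: "G \<in> borel_measurable cube_measure" and B: "AE x in cube_measure. cmod (G x) \<le> B"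
  obtains L where "Linf_norm G = ereal L" "AE x in cube_measure. cmod (G x) \<le> L"
proof -
  have "Linf_norm G \<le> ereal B"
    unfolding Linf_norm_def by (rule esssup_I) (use G B in auto)
  have ae: "AE x in cube_measure. ereal (cmod (G x)) \<le> Linf_norm G"
    unfolding Linf_norm_def by (rule esssup_AE)
  have "Linf_norm G \<noteq> -\<infinity>"
  proof
    assume "Linf_norm G = -\<infinity>"
    with ae have "AE x in (cube_measure :: (real^'n) measure). False" by simp
    then have "emeasure cube_measure (space (cube_measure :: (real^'n) measure)) = 0"
      unfolding ae_filter_eq_bot_iff[symmetric] eventually_False .
    then show False by (simp add: emeasure_restrict_space emeasure_unit_cube)
  qed
  then obtain L where L: "Linf_norm G = ereal L"
    using \<open>Linf_norm G \<le> ereal B\<close> by (cases "Linf_norm G") auto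
  then show ?thesis using that ae by simp
qed

text \<open>Partial sums along \<open>\<kappa>\<close> are coefficient sums over finite sets, so the
  single bound \<open>L\<close> gives both summability and \<open>suminf a \<le> L\<close>. Since
  \<open>\<kappa>\<close> exhausts the integer vectors, the difference of \<open>f\<close> and the
  series has no coefficient left.\<close>

lemma nonneg_coeffs_series:
  fixes f :: "real ^ 'n \<Rightarrow> complex"
  assumes f: "f \<in> borel_measurable cube_measure" and L: "AE x in cube_measure. cmod (f x) \<le> L"
    and real: "\<And>k. int_vec k \<Longrightarrow> Im (fourier_coeff f k) = 0"
    and pos: "\<And>k. int_vec k \<Longrightarrow> Re (fourier_coeff f k) \<ge> 0"
    and mean: "fourier_coeff f 0 = 0"
  obtains \<kappa> a where "positive_fourier_series \<kappa> a" "suminf a \<le> L"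
    "\<And>n. \<kappa> n = 0 \<Longrightarrow> a n = 0"
    "AE x in cube_measure. f x = positive_fourier_series.series \<kappa> a x"
proof -
  obtain \<kappa> :: "nat \<Rightarrow> real ^ 'n" where \<kappa>: "inj \<kappa>" "range \<kappa> = {k. int_vec k}"
    using int_vec_enumeration by blast
  have int: "int_vec (\<kappa> n)" for n using \<kappa>(2) by blast
  define a where "a n = Re (fourier_coeff f (\<kappa> n))" for n
  have nn: "a n \<ge> 0" for n unfolding a_def by (rule pos[OF int])
  have partial: "(\<Sum>n<N. a n) \<le> L" for N
  proof -
    have "(\<Sum>n<N. a n) = (\<Sum>k\<in>\<kappa> ` {..<N}. Re (fourier_coeff f k))"
      using \<kappa>(1) by (simp add: sum.reindex inj_on_subset a_def)
    also have "\<dots> \<le> L" by (rule sum_nonneg_coeffs_le[OF f L pos]) (auto simp: int)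
    finally show ?thesis .
  qed
  have sm: "summable a" by (rule summableI_nonneg_bounded[OF nn partial])
  have loc: "positive_fourier_series \<kappa> a"
    by unfold_locales (use \<kappa>(1) int nn sm in auto)
  interpret positive_fourier_series \<kappa> a by (rule loc)
  have i_f: "integrable cube_measure f"
    by (rule finite_measure.integrable_const_bound[OF finite_measure_cube L f])
  have i_s: "integrable cube_measure series" using integrable_series_translate[of 0] by simp
  have "vanishing_coeffs (\<lambda>x. f x - series x)"
    unfolding vanishing_coeffs_def
  proof (intro conjI allI impI)
    show "integrable cube_measure (\<lambda>x. f x - series x)"
      using i_f i_s by (rule Bochner_Integration.integrable_diff)
    fix k :: "real^'n" assume k: "int_vec k"
    then obtain n where n: "k = \<kappa> n" using \<kappa>(2) by blast
    have "fourier_coeff (\<lambda>x. f x - series x) k = fourier_coeff f k - fourier_coeff series k"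
      unfolding fourier_coeff_eq left_diff_distrib
      by (intro Bochner_Integration.integral_diff integrable_mult_char i_f i_s)
    also have "\<dots> = 0"
      using real[OF k] unfolding n fourier_coeff_series by (simp add: a_def complex_eq_iff)
    finally show "fourier_coeff (\<lambda>x. f x - series x) k = 0" .
  qed
  from fourier_uniqueness[OF this] have "AE x in cube_measure. f x = series x" by simp
  moreover have "a n = 0" if "\<kappa> n = 0" for n using that mean by (simp add: a_def)
  moreover have "suminf a \<le> L" by (rule suminf_le_const[OF sm partial])
  ultimately show ?thesis using that[OF loc] by blast
qed

theorem theorem1p2:
  fixes F :: "real ^ 'n \<Rightarrow> complex" and m :: nat
  defines "F0 \<equiv> (\<lambda>x. F x - fourier_coeff F 0)"
  assumes meas: "F \<in> borel_measurable lebesgue"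
    and per: "one_periodic F"
    and bdd: "Linf_norm F < \<infinity>"
    and real: "\<forall>x. Im (F0 x) = 0"
    and even: "\<forall>x. F0 (- x) = F0 x"
    and pos: "\<forall>k. int_vec k \<and> k \<noteq> 0 \<longrightarrow>
                 Im (fourier_coeff F0 k) = 0 \<and> Re (fourier_coeff F0 k) \<ge> 0"
    and m: "m \<ge> 1"
  shows "\<exists>\<xi>. averaging_search (\<lambda>x. Re (F0 x)) m \<xi> \<and>
             qmc_error m \<xi> (W_F_1 F) \<le> Linf_norm F0 * ereal (1 / sqrt (real m))"
proof -
  interpret cube: finite_measure "cube_measure :: (real^'n) measure" by (rule finite_measure_cube)
  have measure_cube: "measure lebesgue (unit_cube :: (real^'n) set) = 1"
    unfolding measure_def emeasure_unit_cube by simp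
  have int_const: "(\<integral>x. c \<partial>(cube_measure :: (real^'n) measure)) = c" for c :: complex
    by (simp add: measure_restrict_space measure_cube)
  define c0 where "c0 = fourier_coeff F 0"
  have F0: "F0 x = F x - c0" for x by (simp add: F0_def c0_def)
  have F_cube: "F \<in> borel_measurable cube_measure" by (rule measurable_restrict_space1[OF meas])
  then have F0_cube: "F0 \<in> borel_measurable cube_measure" unfolding F0_def by measurable
  obtain B where "Linf_norm F \<le> ereal B" using bdd by (cases "Linf_norm F") auto
  moreover have "AE x in cube_measure. ereal (cmod (F x)) \<le> Linf_norm F"
    unfolding Linf_norm_def by (rule esssup_AE)
  ultimately have F_B: "AE x in cube_measure. cmod (F x) \<le> B"
    by (auto elim!: eventually_mono dest: order_trans)
  have "AE x in cube_measure. cmod (F0 x) \<le> B + cmod c0"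
    using F_B
  proof eventually_elim
    case (elim x)
    then show ?case using norm_triangle_ineq4[of "F x" c0] by (simp add: F0)
  qed
  then obtain L where L: "Linf_norm F0 = ereal L" "AE x in cube_measure. cmod (F0 x) \<le> L"
    using Linf_norm_finite[OF F0_cube] by blast
  have i_F: "integrable cube_measure F" by (rule cube.integrable_const_bound[OF F_B F_cube])
  have mean: "fourier_coeff F0 0 = 0"
    using i_F int_const by (simp add: fourier_coeff_eq F0 c0_def Bochner_Integration.integral_diff)
  \<comment> \<open>Subtracting the mean settles frequency 0, which the sign assumption leaves
    out.\<close>
  have "Im (fourier_coeff F0 k) = 0" "Re (fourier_coeff F0 k) \<ge> 0" if "int_vec k" for k
    using pos that mean by (cases "k = 0"; simp)+
  then obtain \<kappa> a where loc: "positive_fourier_series \<kappa> a" and a_L: "suminf a \<le> L"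
    and zero: "\<And>n. \<kappa> n = 0 \<Longrightarrow> a n = 0"
    and eq: "AE x in cube_measure. F0 x = positive_fourier_series.series \<kappa> a x"
    using nonneg_coeffs_series[OF F0_cube L(2) _ _ mean] by blast
  interpret positive_fourier_series \<kappa> a by (rule loc)
  have per0: "one_periodic F0" using per by (simp add: one_periodic_def F0)
  obtain \<xi> where \<xi>: "\<forall>n\<in>{1..m}. \<xi> n \<in> unit_cube \<and>
     (\<Sum>j=1..n-1. Re (series (\<xi> n - \<xi> j))) \<le> 0 \<and>
     (\<forall>j\<in>{1..n-1}. F0 (\<xi> n - \<xi> j) = series (\<xi> n - \<xi> j))"
    using averaging_points_exist[OF zero per0 eq] by blast
  have av: "averaging_search (\<lambda>x. Re (F0 x)) m \<xi>"
    unfolding averaging_search_def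
  proof (intro conjI ballI)
    fix n assume "n \<in> {2..m}"
    then have n: "n \<in> {1..m}" by auto
    have "(\<Sum>j=1..n-1. Re (F0 (\<xi> n - \<xi> j))) = (\<Sum>j=1..n-1. Re (series (\<xi> n - \<xi> j)))"
      using \<xi> n by (intro sum.cong refl) auto
    then show "(\<Sum>j=1..n-1. Re (F0 (\<xi> n - \<xi> j))) \<le> 0" using \<xi> n by auto
  qed (use \<xi> in auto)
  have error: "cmod ((\<integral>x. f x \<partial>cube_measure) - qmc m \<xi> f) \<le> L * (1 / sqrt (real m))" if W: "f \<in> W_F_1 F" for f
  proof -
    obtain \<phi> where \<phi>: "integrable cube_measure \<phi>" "(\<integral>y. cmod (\<phi> y) \<partial>cube_measure) \<le> 1"
      and f: "f = (\<lambda>x. \<integral>y. F (x - y) * \<phi> y \<partial>cube_measure)"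
      using W unfolding W_F_1_def mem_Collect_eq by (elim exE conjE)
    define h where "h x = (\<integral>y. series (x - y) * \<phi> y \<partial>cube_measure)" for x
    note h = convolution_series[OF \<phi> zero, folded h_def]
    \<comment> \<open>The mean of \<open>F\<close> adds this constant to every value of
      \<open>f\<close>; it enters the integral and the cubature sum alike and cancels in the
      error.\<close>
    define \<Phi> where "\<Phi> = c0 * (\<integral>y. \<phi> y \<partial>cube_measure)"
    have f_eq: "f x = \<Phi> + h x" for x
    proof -
      have i_s: "integrable cube_measure (\<lambda>y. series (x - y) * \<phi> y)"
      proof -
        have "(\<lambda>y. series (x - y)) \<in> borel_measurable cube_measure"
          by (rule borel_measurable_cubeI) measurable
        from integrable_mult_bounded[OF \<phi>(1) this AE_I2[OF cmod_series_le]]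
        show ?thesis by (simp add: mult.commute)
      qed
      have "f x = (\<integral>y. c0 * \<phi> y + series (x - y) * \<phi> y \<partial>cube_measure)"
        unfolding f
      proof (rule integral_cong_AE)
        show "(\<lambda>y. F (x - y) * \<phi> y) \<in> borel_measurable cube_measure"
          using measurable_reflect_translate[OF meas] \<phi>(1) by measurable
        show "(\<lambda>y. c0 * \<phi> y + series (x - y) * \<phi> y) \<in> borel_measurable cube_measure"
          by (rule borel_measurable_integrable) (use i_s \<phi>(1) in simp)
        \<comment> \<open>For each fixed \<open>x\<close> the disagreement is null in
          \<open>y\<close>, so \<open>f x\<close> and its expression through the series coincide at
          every \<open>x\<close>, in particular at the search points.\<close>
        show "AE y in cube_measure. F (x - y) * \<phi> y = c0 * \<phi> y + series (x - y) * \<phi> y"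
          using AE_cube_translates(1)[OF per0 one_periodic_series eq, of x]
          by eventually_elim (simp add: F0 algebra_simps)
      qed
      also have "\<dots> = \<Phi> + h x"
        using i_s \<phi>(1) by (simp add: \<Phi>_def h_def)
      finally show ?thesis .
    qed
    have "(\<integral>x. f x \<partial>cube_measure) = \<Phi>"
      unfolding f_eq using h(1,2) int_const by simp
    moreover have "qmc m \<xi> f = \<Phi> + (\<Sum>j=1..m. h (\<xi> j)) / of_nat m"
      using m by (simp add: qmc_def f_eq sum.distrib add_divide_distrib)
    ultimately have "cmod ((\<integral>x. f x \<partial>cube_measure) - qmc m \<xi> f) = cmod (\<Sum>j=1..m. h (\<xi> j)) / real m"
      by (simp add: norm_divide)
    also have "\<dots> \<le> sqrt (real m) * suminf a / real m"
      by (intro divide_right_mono h(3) m) (use \<xi> in auto)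
    also have "\<dots> = suminf a * (1 / sqrt (real m))"
      using real_div_sqrt[of "real m"] m by (simp add: field_simps)
    also have "\<dots> \<le> L * (1 / sqrt (real m))"
      using a_L by (intro mult_right_mono) auto
    finally show ?thesis .
  qed
  have "qmc_error m \<xi> (W_F_1 F) \<le> Linf_norm F0 * ereal (1 / sqrt (real m))"
    unfolding qmc_error_def L(1) times_ereal.simps(1)
    by (rule SUP_least) (use error in auto)
  with av show ?thesis by blast
qed

end
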